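(* For any infinite metric space $M$ there exist an extremally disconnected compact (Hausdorff) space $K$ with $d(K)=d(M)$ and $w(K)=2^{d(M)}$ and a continuous linear surjection $T\colon\mathrm{Lip}_0(M)\to C(K)$ between Banach spaces.
   Context: All vector spaces are real. For a topological space $X$, $d(X)$ denotes the density (minimal cardinality of a dense subset) and $w(X)$ the weight (minimal cardinality of a base). $X$ is extremally disconnected if the closure of every open subset of $X$ is open. For a metric space $(M,\rho)$ with a distinguished base point $e$, $\mathrm{Lip}_0(M)$ is the Banach space of all Lipschitz functions $f\colon M\to\mathbb{R}$ with $f(e)=0$, with norm $\|f\|=\mathrm{Lip}(f)=\sup_{x\neq y}|f(x)-f(y)|/\rho(x,y)$. $C(K)$ is the Banach space of continuous real-valued functions on $K$ with the supremum norm. *)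

theory Defs
  imports "HOL-Analysis.Analysis"
begin

unbundle cardinal_syntax

subsection \<open>Density, weight, extremal disconnectedness\<close>

text \<open>
  Cardinals are cardinal orders, compared with \<open>=o\<close>.  The lemmas \<open>topological_density\<close> and
  \<open>topological_weight\<close> show that the choice operator in the definitions below always finds a
  set of minimal cardinality, so that both cardinals are determined up to \<open>=o\<close>.
\<close>

definition dense_subset :: "'a topology \<Rightarrow> 'a set \<Rightarrow> bool" where
  "dense_subset X D \<longleftrightarrow> D \<subseteq> topspace X \<and> X closure_of D = topspace X"

definition base_of_topology :: "'a topology \<Rightarrow> 'a set set \<Rightarrow> bool" where
  "base_of_topology X \<B> \<longleftrightarrow> openin X = arbitrary union_of (\<lambda>U. U \<in> \<B>)"

definition topological_density :: "'a topology \<Rightarrow> 'a rel" where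
  "topological_density X = |SOME D. dense_subset X D \<and>
     (\<forall>E. dense_subset X E \<longrightarrow> |D| \<le>o |E| )|"

definition topological_weight :: "'a topology \<Rightarrow> 'a set rel" where
  "topological_weight X = |SOME \<B>. base_of_topology X \<B> \<and>
     (\<forall>\<C>. base_of_topology X \<C> \<longrightarrow> |\<B>| \<le>o |\<C>| )|"

lemma exists_least_card:
  assumes "P A"
  shows "\<exists>D. P D \<and> (\<forall>E. P E \<longrightarrow> |D| \<le>o |E| )"
  proof -
  have "card_of ` Collect P \<noteq> {}"
    using assms by blast
  from exists_minim_Card_order[OF this] show ?thesis
    by (auto simp: card_of_Card_order)
qed

lemma topological_density:
  shows "\<exists>D. dense_subset X D \<and> topological_density X = |D|"
    and "dense_subset X E \<Longrightarrow> topological_density X \<le>o |E|"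
proof -
  have "dense_subset X (topspace X)"
    by (simp add: dense_subset_def)
  from someI_ex[OF exists_least_card[of "dense_subset X", OF this]]
  show "\<exists>D. dense_subset X D \<and> topological_density X = |D|"
    and "dense_subset X E \<Longrightarrow> topological_density X \<le>o |E|"
    unfolding topological_density_def by blast+
qed

lemma topological_weight:
  shows "\<exists>\<B>. base_of_topology X \<B> \<and> topological_weight X = |\<B>|"
    and "base_of_topology X \<C> \<Longrightarrow> topological_weight X \<le>o |\<C>|"
proof -
  have "base_of_topology X (Collect (openin X))"
    unfolding base_of_topology_def
    by (subst openin_topology_base_unique) auto
  from someI_ex[OF exists_least_card[of "base_of_topology X", OF this]]
  show "\<exists>\<B>. base_of_topology X \<B> \<and> topological_weight X = |\<B>|"
    and "base_of_topology X \<C> \<Longrightarrow> topological_weight X \<le>o |\<C>|"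
    unfolding topological_weight_def by blast+
qed

definition extremally_disconnected :: "'a topology \<Rightarrow> bool" where
  "extremally_disconnected X \<longleftrightarrow> (\<forall>U. openin X U \<longrightarrow> openin X (X closure_of U))"


subsection \<open>The Banach space of Lipschitz functions vanishing at the base point\<close>

definition Lip0 :: "'a::metric_space \<Rightarrow> ('a \<Rightarrow> real) set" where
  "Lip0 e = {f. (\<exists>L. L-lipschitz_on UNIV f) \<and> f e = 0}"

definition Lip_norm :: "('a::metric_space \<Rightarrow> real) \<Rightarrow> real" where
  "Lip_norm f = Sup {\<bar>f x - f y\<bar> / dist x y | x y. x \<noteq> y}"

text \<open>
  As in the library's function spaces, the distance is \<open>0\<close> outside the carrier: the axioms of
  \<open>Metric_space\<close> on symmetry and nonnegativity are not relativised to the carrier.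
\<close>

definition Lip0_dist :: "'a::metric_space \<Rightarrow> ('a \<Rightarrow> real) \<Rightarrow> ('a \<Rightarrow> real) \<Rightarrow> real" where
  "Lip0_dist e f g = (if f \<in> Lip0 e \<and> g \<in> Lip0 e then Lip_norm (\<lambda>x. f x - g x) else 0)"

definition Lip0_space :: "'a::metric_space \<Rightarrow> ('a \<Rightarrow> real) metric" where
  "Lip0_space e = metric (Lip0 e, Lip0_dist e)"

lemma Lip0_diff: "f \<in> Lip0 e \<Longrightarrow> g \<in> Lip0 e \<Longrightarrow> (\<lambda>x. f x - g x) \<in> Lip0 e"
  unfolding Lip0_def using lipschitz_on_diff by fastforce

lemma Lip_norm_bdd:
  assumes "f \<in> Lip0 e"
  shows "bdd_above {\<bar>f x - f y\<bar> / dist x y | x y. x \<noteq> y}"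
proof -
  from assms obtain L where "L-lipschitz_on UNIV f"
    by (auto simp: Lip0_def)
  then have "\<bar>f x - f y\<bar> / dist x y \<le> L" if "x \<noteq> y" for x y
    using that by (simp add: lipschitz_on_def dist_real_def divide_le_eq)
  then show ?thesis
    by (intro bdd_aboveI[of _ L]) auto
qed

lemma Lip_norm_upper:
  assumes "f \<in> Lip0 e"
  shows "\<bar>f x - f y\<bar> \<le> Lip_norm f * dist x y"
proof (cases "x = y")
  case False
  then have "\<bar>f x - f y\<bar> / dist x y \<le> Lip_norm f"
    unfolding Lip_norm_def by (intro cSup_upper Lip_norm_bdd[OF assms]) auto
  with False show ?thesis
    by (simp add: divide_le_eq)
qed simp

lemma Lip_norm_least:
  fixes f :: "'a::metric_space \<Rightarrow> real"
  assumes "(a::'a) \<noteq> b" and "\<And>x y. \<bar>f x - f y\<bar> \<le> L * dist x y"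
  shows "Lip_norm f \<le> L"
  unfolding Lip_norm_def
  by (rule cSup_least) (use assms in \<open>auto simp: divide_le_eq\<close>)

lemma Metric_space_Lip0:
  fixes e :: "'a::metric_space"
  assumes "infinite (UNIV :: 'a set)"
  shows "Metric_space (Lip0 e) (Lip0_dist e)"
proof -
  obtain a :: 'a where ae: "a \<noteq> e"
    using assms by (metis finite.emptyI finite_insert finite_subset insertI1 subsetI)
  have nonneg: "0 \<le> Lip_norm f" if "f \<in> Lip0 e" for f
  proof -
    have "0 \<le> Lip_norm f * dist a e"
      using Lip_norm_upper[OF that, of a e] by linarith
    then show ?thesis
      using ae by (simp add: zero_le_mult_iff)
  qed
  have bound: "\<bar>(f x - g x) - (f y - g y)\<bar> \<le> Lip0_dist e f g * dist x y"
    if "f \<in> Lip0 e" "g \<in> Lip0 e" for f g x y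
    using Lip_norm_upper[OF Lip0_diff[OF that], of x y] that by (simp add: Lip0_dist_def)
  have least: "Lip0_dist e f g \<le> L"
    if "f \<in> Lip0 e" "g \<in> Lip0 e" "\<And>x y. \<bar>(f x - g x) - (f y - g y)\<bar> \<le> L * dist x y" for f g L
    using that Lip_norm_least[OF ae, of "\<lambda>x. f x - g x" L] by (simp add: Lip0_dist_def)
  show ?thesis
  proof (rule Metric_space.intro)
    fix f g :: "'a \<Rightarrow> real"
    show nn: "0 \<le> Lip0_dist e f g"
      by (simp add: Lip0_dist_def nonneg Lip0_diff)
    have le: "Lip0_dist e f g \<le> Lip0_dist e g f" if "f \<in> Lip0 e" "g \<in> Lip0 e" for f g
    proof (rule least[OF that])
      show "\<bar>(f x - g x) - (f y - g y)\<bar> \<le> Lip0_dist e g f * dist x y" for x y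
        using bound[OF that(2,1), of x y] by linarith
    qed
    show "Lip0_dist e f g = Lip0_dist e g f"
    proof (cases "f \<in> Lip0 e \<and> g \<in> Lip0 e")
      case True
      then show ?thesis
        using le by (metis order_antisym)
    qed (auto simp: Lip0_dist_def)
    assume f: "f \<in> Lip0 e" and g: "g \<in> Lip0 e"
    show "Lip0_dist e f g = 0 \<longleftrightarrow> f = g"
    proof
      assume 0: "Lip0_dist e f g = 0"
      have "f x = g x" for x
        using bound[OF f g, of x e] f g by (simp add: 0 Lip0_def)
      then show "f = g" ..
    next
      assume "f = g"
      then show "Lip0_dist e f g = 0"
        using least[OF f f, of 0] nn by simp
    qed
    fix h :: "'a \<Rightarrow> real"
    assume h: "h \<in> Lip0 e"
    show "Lip0_dist e f h \<le> Lip0_dist e f g + Lip0_dist e g h"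
    proof (rule least[OF f h])
      show "\<bar>(f x - h x) - (f y - h y)\<bar> \<le> (Lip0_dist e f g + Lip0_dist e g h) * dist x y" for x y
        using bound[OF f g, of x y] bound[OF g h, of x y] unfolding distrib_right by linarith
    qed
  qed
qed

lemma Lip0_space:
  fixes e :: "'a::metric_space"
  assumes "infinite (UNIV :: 'a set)"
  shows "mspace (Lip0_space e) = Lip0 e" and "mdist (Lip0_space e) = Lip0_dist e"
  using Metric_space_Lip0[OF assms]
  by (simp_all add: Lip0_space_def Metric_space.mspace_metric Metric_space.mdist_metric)


subsection \<open>Linear operators from Lipschitz functions to continuous functions\<close>

text \<open>
  The Banach space \<open>C(K)\<close> is the library's \<open>cfunspace K euclidean_metric\<close>: the continuous functions
  on \<open>topspace K\<close> with the supremum metric.  Its elements are \<open>undefined\<close> outside \<open>topspace K\<close>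
  (and bounded, which is automatic for compact \<open>K\<close>), so its vector operations are pointwise
  on \<open>topspace K\<close> only.
\<close>

abbreviation C_space :: "'k topology \<Rightarrow> ('k \<Rightarrow> real) metric" where
  "C_space K \<equiv> cfunspace K euclidean_metric"

definition linear_Lip0_C ::
  "'a::metric_space \<Rightarrow> 'k topology \<Rightarrow> (('a \<Rightarrow> real) \<Rightarrow> ('k \<Rightarrow> real)) \<Rightarrow> bool" where
  "linear_Lip0_C e K T \<longleftrightarrow>
     (\<forall>f\<in>Lip0 e. \<forall>g\<in>Lip0 e. \<forall>k\<in>topspace K. T (\<lambda>x. f x + g x) k = T f k + T g k) \<and>
     (\<forall>c. \<forall>f\<in>Lip0 e. \<forall>k\<in>topspace K. T (\<lambda>x. c * f x) k = c * T f k)"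

lemma mspace_C_space:
  assumes "compact_space K"
  shows "mspace (C_space K) = {g \<in> extensional (topspace K). continuous_map K euclideanreal g}"
proof -
  have "bounded (g ` topspace K)" if "continuous_map K euclideanreal g" for g :: "'a \<Rightarrow> real"
    using image_compactin[OF assms[unfolded compact_space_def] that]
    by (simp add: compact_imp_bounded)
  then show ?thesis
    by (auto simp: Met_TC.fspace_def)
qed

lemma mdist_C_space:
  assumes "f \<in> mspace (C_space K)" "g \<in> mspace (C_space K)" "topspace K \<noteq> {}"
  shows "mdist (C_space K) f g = (SUP k\<in>topspace K. \<bar>f k - g k\<bar>)"
  using assms by (simp add: Met_TC.fdist_def dist_real_def cfunspace_def)

end

theory Submission
  imports Defs
begin

text \<open>
  Write \<open>d\<close> for the density of \<open>M\<close>.  The space \<open>K\<close> is the Stone-Cech compactification of a discrete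
  set \<open>S\<close> of cardinality \<open>d\<close>, for which \<open>C(K)\<close> is the space of bounded functions on \<open>S\<close>.  It
  therefore suffices to find \<open>d\<close> difference quotients \<open>f \<mapsto> (f x - f (y x)) / dist x (y x)\<close>,
  indexed by \<open>x \<in> S \<subseteq> M\<close>, that interpolate: every bounded family of values on \<open>S\<close> is attained
  by one Lipschitz function.

  Such quotients exist because of three facts.  First, \<open>M\<close> has a discrete subset \<open>D\<close> whose
  cardinality is \<open>d\<close> itself, also when \<open>d\<close> is singular of countable cofinality and the uniformly
  discrete subsets are all smaller (\<open>discrete_subset_of_density_size\<close>).  Secondly, in a discrete
  set, balls whose radii are half the distance to the rest of the set are disjoint.  Pairing each
  point with an almost nearest neighbour and passing to a subset \<open>S\<close> of the same size that contains
  no pair, all partners lie outside all balls around \<open>S\<close> and yet within a bounded multiple of the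
  radius (\<open>bump_system_exists\<close>).  Thirdly, multiples of cone-shaped bumps on disjoint balls with
  uniformly bounded slopes add up to a Lipschitz function (\<open>Lip0_interpolation\<close>).

  The compactification is realised as the space of ultrafilters on \<open>S\<close>.  Its points are sets of
  subsets of \<open>M\<close>, its clopen sets correspond to the subsets of \<open>S\<close>, and the isomorphism of the
  bounded functions on \<open>S\<close> with \<open>C(K)\<close> takes limits along ultrafilters.  The operator of the theorem
  maps \<open>f\<close> to the extension of its family of difference quotients.
\<close>

section \<open>Discrete subsets as large as the density\<close>

text \<open>
  The instance of Zorn's lemma behind the choice of separated sets, of disjoint families of open
  sets, and of independent sets of vertices.  Both orders of the arguments occur in the conclusion
  because \<open>R\<close> may be asymmetric.
\<close>

lemma maximal_pairwise:
  "\<exists>B\<subseteq>A. pairwise R B \<and> (\<forall>x\<in>A. x \<notin> B \<longrightarrow> (\<exists>y\<in>B. \<not> R x y \<or> \<not> R y x))"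
proof -
  let ?P = "{B. B \<subseteq> A \<and> pairwise R B}"
  have "\<Union>C \<in> ?P" if "subset.chain ?P C" for C
  proof -
    have C: "C \<subseteq> ?P" "chain\<^sub>\<subseteq> C"
      using that by (simp_all add: subset_chain_def chain_subset_def)
    then have "pairwise R (\<Union>C)"
      by (intro pairwise_chain_Union) auto
    with C(1) show ?thesis
      by blast
  qed
  then have "\<exists>B\<in>?P. \<forall>X\<in>?P. B \<subseteq> X \<longrightarrow> X = B"
    by (rule subset_Zorn')
  then obtain B where "B \<in> ?P" and max: "\<forall>X\<in>?P. B \<subseteq> X \<longrightarrow> X = B"
    by (rule bexE)
  then have B: "B \<subseteq> A" "pairwise R B"
    by simp_all
  have "\<exists>y\<in>B. \<not> R x y \<or> \<not> R y x" if "x \<in> A" "x \<notin> B" for x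
  proof (rule ccontr)
    assume "\<not> (\<exists>y\<in>B. \<not> R x y \<or> \<not> R y x)"
    then have "pairwise R (insert x B)"
      using B(2) by (auto simp: pairwise_insert)
    with B(1) that(1) have "insert x B = B"
      using max by blast
    with that(2) show False
      by blast
  qed
  with B show ?thesis
    by blast
qed

lemma card_of_UNION_mono_disjoint:
  assumes "disjoint_family_on B I" and "\<And>i. i \<in> I \<Longrightarrow> |A i| \<le>o |B i|"
  shows "|\<Union>i\<in>I. A i| \<le>o |\<Union>i\<in>I. B i|"
proof -
  have "inj_on snd (SIGMA i:I. B i)"
    using assms(1) by (fastforce simp: inj_on_def disjoint_family_on_def)
  then have "|SIGMA i:I. B i| \<le>o |\<Union>i\<in>I. B i|"
    by (force simp flip: card_of_ordLeq)
  with card_of_UNION_Sigma[of A I] card_of_Sigma_mono1[of I A B] assms(2) show ?thesis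
    by (meson ordLeq_transitive)
qed

lemma discrete_UNION_disjoint_open:
  fixes D U :: "'i \<Rightarrow> 'a::metric_space set"
  assumes "disjoint_family_on U I" and "\<And>i. i \<in> I \<Longrightarrow> open (U i)"
    and "\<And>i. i \<in> I \<Longrightarrow> D i \<subseteq> U i" and "\<And>i. i \<in> I \<Longrightarrow> discrete (D i)"
  shows "discrete (\<Union>i\<in>I. D i)"
  unfolding discrete_def
proof
  fix x assume x: "x \<in> (\<Union>i\<in>I. D i)"
  then obtain i where i: "i \<in> I" "x \<in> D i"
    by blast
  then have "x isolated_in D i"
    using assms(4) by (auto simp: discrete_def)
  then obtain V where V: "open V" "V \<inter> D i = {x}"
    by (auto simp: isolated_in_def)
  have "D j \<inter> U i = {}" if "j \<in> I" "j \<noteq> i" for j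
    using that i(1) assms(1,3) by (fastforce simp: disjoint_family_on_def)
  then have "(V \<inter> U i) \<inter> (\<Union>i\<in>I. D i) = {x}"
    using V i assms(3) by blast
  moreover have "open (V \<inter> U i)"
    using V i assms(2) by blast
  ultimately show "x isolated_in (\<Union>i\<in>I. D i)"
    unfolding isolated_in_def using x by blast
qed

text \<open>
  A maximal set of points of \<open>U\<close> at mutual distance at least \<open>1 / Suc n\<close> comes within
  \<open>1 / Suc n\<close> of every point of \<open>U\<close>, so these sets for all \<open>n\<close> are jointly dense.
\<close>

lemma uniform_discrete_exhaustion:
  fixes U :: "'a::metric_space set"
  obtains S :: "nat \<Rightarrow> 'a set"
  where "\<And>n. S n \<subseteq> U" "\<And>n. uniform_discrete (S n)" "U \<subseteq> closure (\<Union>n. S n)"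
proof -
  have "\<exists>B \<subseteq> U. pairwise (\<lambda>x y. 1 / Suc n \<le> dist x y) B \<and>
      (\<forall>x\<in>U. x \<notin> B \<longrightarrow> (\<exists>y\<in>B. dist y x < 1 / Suc n))" for n
    using maximal_pairwise[of U "\<lambda>x y. 1 / Suc n \<le> dist x y"] by (simp add: dist_commute not_le)
  then obtain S where S: "\<And>n. S n \<subseteq> U" "\<And>n. pairwise (\<lambda>x y. 1 / Suc n \<le> dist x y) (S n)"
    "\<And>n x. x \<in> U \<Longrightarrow> x \<notin> S n \<Longrightarrow> \<exists>y\<in>S n. dist y x < 1 / Suc n"
    by metis
  show thesis
  proof (rule that)
    show "S n \<subseteq> U" for n
      by (rule S)
    show "uniform_discrete (S n)" for n
      unfolding uniform_discrete_def
    proof (intro exI conjI ballI impI)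
      show "0 < 1 / real (Suc n)"
        by simp
      show "x = y" if "x \<in> S n" "y \<in> S n" "dist x y < 1 / real (Suc n)" for x y
        using pairwiseD[OF S(2)[of n] that(1,2)] that(3) by linarith
    qed
    show "U \<subseteq> closure (\<Union>n. S n)"
    proof
      fix x assume x: "x \<in> U"
      have "\<exists>y\<in>\<Union>n. S n. dist y x < \<epsilon>" if "\<epsilon> > 0" for \<epsilon>
      proof -
        obtain n where n: "1 / Suc n < \<epsilon>"
          by (rule nat_approx_posE[OF \<open>\<epsilon> > 0\<close>])
        have "\<exists>y\<in>S n. dist y x < 1 / Suc n"
          using S(3)[OF x, of n] by (cases "x \<in> S n") force+
        with n show ?thesis
          by (meson UN_I UNIV_I less_trans)
      qed
      then show "x \<in> closure (\<Union>n. S n)"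
        by (auto simp: closure_approachable)
    qed
  qed
qed

text \<open>
  Points of \<open>U\<close> that approach a fixed point of \<open>U\<close> fast enough lie in disjoint open annuli
  around it.
\<close>

lemma infinitely_many_disjoint_open:
  fixes U :: "'a::metric_space set"
  assumes "open U" "U \<noteq> {}" and crowded: "\<And>V. open V \<Longrightarrow> V \<noteq> {} \<Longrightarrow> V \<subseteq> U \<Longrightarrow> infinite V"
  obtains V :: "nat \<Rightarrow> 'a set"
  where "disjoint_family V" "\<And>n. open (V n)" "\<And>n. V n \<noteq> {}" "\<And>n. V n \<subseteq> U"
proof -
  obtain x where x: "x \<in> U"
    using assms by blast
  have near: "\<exists>y\<in>U. y \<noteq> x \<and> dist x y < r" if "r > 0" for r
  proof -
    have "infinite (U \<inter> ball x r)"
      by (rule crowded) (use assms(1) x that in auto)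
    then have "\<not> U \<inter> ball x r \<subseteq> {x}"
      using finite_subset by blast
    then show ?thesis
      by auto
  qed
  have "\<exists>y. \<forall>n. (y n \<in> U \<and> y n \<noteq> x) \<and> dist x (y (Suc n)) < dist x (y n) / 4"
  proof (rule dependent_nat_choice)
    show "\<exists>y. y \<in> U \<and> y \<noteq> x"
      using near[of 1] by auto
    show "\<exists>z. (z \<in> U \<and> z \<noteq> x) \<and> dist x z < dist x y / 4" if "y \<in> U \<and> y \<noteq> x" for y and n :: nat
      using near[of "dist x y / 4"] that by auto
  qed
  then obtain y where y: "\<And>n. y n \<in> U" "\<And>n. y n \<noteq> x"
    and dec: "\<And>n. dist x (y (Suc n)) < dist x (y n) / 4"
    by blast
  have "dist x (y (Suc n)) \<le> dist x (y n)" for n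
    using dec[of n] zero_le_dist[of x "y n"] by linarith
  then have le: "dist x (y n) \<le> dist x (y m)" if "m \<le> n" for m n
    using lift_Suc_antimono_le[of "\<lambda>n. dist x (y n)", OF _ that] by blast
  \<comment> \<open>The factor \<open>1 / 4\<close> between consecutive distances makes the annuli disjoint.\<close>
  define V where "V n = U \<inter> {z. dist x (y n) / 2 < dist x z \<and> dist x z < 2 * dist x (y n)}" for n
  have disj: "V m \<inter> V n = {}" if "m < n" for m n
    using le[of "Suc m" n] dec[of m] that by (auto simp: V_def)
  show thesis
  proof (rule that)
    show "disjoint_family V"
      using disj by (auto simp: disjoint_family_on_def) (metis IntI empty_iff linorder_neqE_nat)
    show "open (V n)" for n
      unfolding V_def
      by (intro open_Int assms(1) open_Collect_conj open_Collect_less continuous_intros)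
    show "V n \<noteq> {}" for n
      using y[of n] by (auto simp: V_def)
    show "V n \<subseteq> U" for n
      by (auto simp: V_def)
  qed
qed

text \<open>
  Countably many uniformly discrete sets exhaust \<open>V\<close>.  If \<open>A\<close> is infinite and all of them are
  smaller than \<open>A\<close>, then their dense union is no larger than \<open>A\<close>, in contradiction to the lower
  bound for dense sets.
\<close>

lemma discrete_subset_above_small_cardinal:
  fixes V :: "'a::metric_space set"
  assumes "infinite V" and "|A| <o |E|" and dense: "\<And>F. V \<subseteq> closure F \<Longrightarrow> |E| \<le>o |F|"
  obtains T where "T \<subseteq> V" "discrete T" "|A| \<le>o |T|"
proof (cases "finite A")
  case True
  obtain T where T: "T \<subseteq> V" "finite T" "card T = card A"
    using infinite_arbitrarily_large[OF assms(1)] by metis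
  have "discrete T"
    using T(2) by (simp add: discrete_def isolated_in_islimpt_iff islimpt_finite card_of_mono1)
  moreover have "|A| \<le>o |T|"
    using T True by (metis card_of_ordLeq bij_betw_def finite_same_card_bij order_refl)
  ultimately show ?thesis
    using T that by blast
next
  case False
  obtain T where T: "\<And>n::nat. T n \<subseteq> V" "\<And>n. uniform_discrete (T n)" "V \<subseteq> closure (\<Union>n. T n)"
    using uniform_discrete_exhaustion by blast
  have "\<exists>n. |A| \<le>o |T n|"
  proof (rule ccontr)
    assume "\<nexists>n. |A| \<le>o |T n|"
    then have "|T n| \<le>o |A|" for n
      by (meson card_of_Well_order ordLeq_total)
    then have "|\<Union>n. T n| \<le>o |A|"
      using False by (intro card_of_UNION_ordLeq_infinite) (auto simp flip: infinite_iff_card_of_nat)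
    with dense[OF T(3)] assms(2) show False
      by (meson not_ordLess_ordLeq ordLeq_transitive)
  qed
  then show ?thesis
    using T uniform_discrete_imp_discrete that by blast
qed

text \<open>
  For open \<open>U\<close> the part of \<open>E\<close> inside \<open>U\<close> is dense in \<open>U\<close>, so \<open>|E|\<close> bounds the density of \<open>U\<close>.
\<close>

definition realises_density :: "'a::metric_space set \<Rightarrow> bool" where
  "realises_density U \<longleftrightarrow> (\<exists>D E. D \<subseteq> U \<and> discrete D \<and> U \<subseteq> closure E \<and> |E| \<le>o |D| )"

text \<open>
  Choose \<open>U\<close> with a dense subset \<open>E\<close> of the least cardinality that occurs among the nonempty open
  subsets of \<open>W\<close>; then no nonempty open subset of \<open>U\<close> is of smaller density.  The uniformly discrete
  sets \<open>S n\<close> that exhaust \<open>U\<close> may all be smaller than \<open>E\<close>, with cardinalities that only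
  approach that of \<open>E\<close>.  In this case one finds, in disjoint open subsets \<open>V n\<close> of \<open>U\<close>, discrete
  sets at least as large as the \<open>S n\<close>.  Being separated by the \<open>V n\<close>, they have a discrete union,
  and no cofinality argument is needed.
\<close>

lemma realises_density_locally:
  fixes W :: "'a::metric_space set"
  assumes "open W" "W \<noteq> {}"
  obtains U where "open U" "U \<noteq> {}" "U \<subseteq> W" "realises_density U"
proof -
  define P where "P E \<longleftrightarrow> (\<exists>U. open U \<and> U \<noteq> {} \<and> U \<subseteq> W \<and> U \<subseteq> closure E)" for E
  have "P W"
    unfolding P_def using assms closure_subset by blast
  then obtain E where "P E" and least_P: "\<And>F. P F \<Longrightarrow> |E| \<le>o |F|"
    using exists_least_card[of P] by metis
  then obtain U where U: "open U" "U \<noteq> {}" "U \<subseteq> W" "U \<subseteq> closure E"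
    unfolding P_def by blast
  have least: "|E| \<le>o |F|" if "open V" "V \<noteq> {}" "V \<subseteq> U" "V \<subseteq> closure F" for V F
  proof (rule least_P)
    show "P F"
      unfolding P_def using that U(3) by (meson order_trans)
  qed
  have "realises_density U"
  proof (cases "finite E")
    case True
    then have "U \<subseteq> E"
      using U(4) True finite_imp_closed closure_closed by metis
    then have "finite U"
      using True finite_subset by blast
    then show ?thesis
      unfolding realises_density_def using closure_subset[of U]
      by (intro exI[of _ U]) (simp add: discrete_def isolated_in_islimpt_iff islimpt_finite card_of_mono1)
  next
    case False
    have crowded: "infinite V" if "open V" "V \<noteq> {}" "V \<subseteq> U" for V
      using least[OF that closure_subset] False card_of_ordLeq_finite by blast
    obtain S where S: "\<And>n::nat. S n \<subseteq> U" "\<And>n. uniform_discrete (S n)" "U \<subseteq> closure (\<Union>n. S n)"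
      using uniform_discrete_exhaustion by blast
    show ?thesis
    proof (cases "\<exists>n. |E| \<le>o |S n|")
      case True
      then show ?thesis
        unfolding realises_density_def using U(4) S uniform_discrete_imp_discrete by blast
    next
      case small: False
      have "\<exists>V :: nat \<Rightarrow> 'a set. disjoint_family V \<and> (\<forall>n. open (V n) \<and> V n \<noteq> {} \<and> V n \<subseteq> U)"
        by (rule infinitely_many_disjoint_open[OF U(1,2)]) (use crowded in blast)+
      then obtain V :: "nat \<Rightarrow> 'a set"
        where V': "disjoint_family V \<and> (\<forall>n. open (V n) \<and> V n \<noteq> {} \<and> V n \<subseteq> U)"
        by (rule exE)
      have V: "disjoint_family V" "\<And>n. open (V n)" "\<And>n. V n \<noteq> {}" "\<And>n. V n \<subseteq> U"
        using V' by simp_all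
      have "\<exists>T. T \<subseteq> V n \<and> discrete T \<and> |S n| \<le>o |T|" for n
      proof (rule discrete_subset_above_small_cardinal[of "V n" "S n" E])
        show "infinite (V n)"
          by (rule crowded[OF V(2-4)])
        show "|S n| <o |E|"
          using small by (meson card_of_Well_order not_ordLeq_iff_ordLess)
        show "|E| \<le>o |F|" if "V n \<subseteq> closure F" for F
          by (rule least[OF V(2-4) that])
      qed blast
      then have "\<exists>T. \<forall>n. T n \<subseteq> V n \<and> discrete (T n) \<and> |S n| \<le>o |T n|"
        by (intro choice) simp
      then obtain T where T': "\<forall>n. T n \<subseteq> V n \<and> discrete (T n) \<and> |S n| \<le>o |T n|"
        by (rule exE)
      have T: "\<And>n. T n \<subseteq> V n" "\<And>n. discrete (T n)" "\<And>n. |S n| \<le>o |T n|"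
        using T' by simp_all
      have "disjoint_family T"
        using V(1) T(1) by (rule disjoint_family_subset)
      then have "|\<Union>n. S n| \<le>o |\<Union>n. T n|"
        by (rule card_of_UNION_mono_disjoint) (rule T)
      moreover have "discrete (\<Union>n. T n)"
        using V(1,2) T(1,2) by (rule discrete_UNION_disjoint_open)
      moreover have "(\<Union>n. T n) \<subseteq> U"
        using T(1) V(4) by blast
      ultimately show ?thesis
        unfolding realises_density_def using S(3) by (intro exI conjI)
    qed
  qed
  with U that show ?thesis
    by blast
qed

text \<open>
  A maximal disjoint family of open sets that realise their density has a dense union, as every
  nonempty open set contains such a set.  The discrete sets chosen in the members unite to a
  discrete set, and the dense sets chosen unite to a dense set.
\<close>

lemma discrete_subset_realises_density:
  obtains D E :: "'a::metric_space set"
  where "discrete D" "closure E = UNIV" "|E| \<le>o |D|"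
proof -
  obtain \<U> :: "'a set set" where \<U>: "\<U> \<subseteq> {U. open U \<and> realises_density U}"
    "pairwise disjnt \<U>"
    and max: "\<forall>U\<in>{U. open U \<and> realises_density U}. U \<notin> \<U> \<longrightarrow>
      (\<exists>V\<in>\<U>. \<not> disjnt U V \<or> \<not> disjnt V U)"
    using maximal_pairwise[of "{U. open U \<and> realises_density U}" disjnt] by (elim exE conjE)
  have "\<forall>U\<in>\<U>. \<exists>D E. D \<subseteq> U \<and> discrete D \<and> U \<subseteq> closure E \<and> |E| \<le>o |D|"
    using \<U>(1) by (auto simp: realises_density_def)
  then have "\<exists>D. \<forall>U\<in>\<U>. \<exists>E. D U \<subseteq> U \<and> discrete (D U) \<and> U \<subseteq> closure E \<and> |E| \<le>o |D U|"
    by (rule bchoice)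
  then obtain D where "\<forall>U\<in>\<U>. \<exists>E. D U \<subseteq> U \<and> discrete (D U) \<and> U \<subseteq> closure E \<and> |E| \<le>o |D U|"
    by (rule exE)
  then have "\<exists>E. \<forall>U\<in>\<U>. D U \<subseteq> U \<and> discrete (D U) \<and> U \<subseteq> closure (E U) \<and> |E U| \<le>o |D U|"
    by (rule bchoice)
  then obtain E where "\<forall>U\<in>\<U>. D U \<subseteq> U \<and> discrete (D U) \<and> U \<subseteq> closure (E U) \<and> |E U| \<le>o |D U|"
    by (rule exE)
  then have DE: "\<And>U. U \<in> \<U> \<Longrightarrow> D U \<subseteq> U" "\<And>U. U \<in> \<U> \<Longrightarrow> discrete (D U)"
    "\<And>U. U \<in> \<U> \<Longrightarrow> U \<subseteq> closure (E U)" "\<And>U. U \<in> \<U> \<Longrightarrow> |E U| \<le>o |D U|"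
    by simp_all
  have disj: "disjoint_family_on (\<lambda>U. U) \<U>"
    using \<U>(2) by (auto simp: disjoint_family_on_def pairwise_def disjnt_def)
  then have disjD: "disjoint_family_on D \<U>"
    unfolding disjoint_family_on_def using DE(1) by (meson disjoint_iff subsetD)
  show thesis
  proof (rule that)
    show "discrete (\<Union>U\<in>\<U>. D U)"
      by (rule discrete_UNION_disjoint_open[OF disj]) (use DE \<U> in auto)
    show "|\<Union>U\<in>\<U>. E U| \<le>o |\<Union>U\<in>\<U>. D U|"
      by (rule card_of_UNION_mono_disjoint[OF disjD]) (use DE in auto)
    have "U \<subseteq> closure (\<Union>U\<in>\<U>. E U)" if "U \<in> \<U>" for U
      using DE(3)[OF that] closure_mono[of "E U" "\<Union>U\<in>\<U>. E U"] that by blast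
    then have sub: "\<Union>\<U> \<subseteq> closure (\<Union>U\<in>\<U>. E U)"
      by blast
    have "- closure (\<Union>U\<in>\<U>. E U) = {}"
    proof (rule ccontr)
      assume ne: "- closure (\<Union>U\<in>\<U>. E U) \<noteq> {}"
      obtain W where W: "open W" "W \<noteq> {}" "W \<subseteq> - closure (\<Union>U\<in>\<U>. E U)" "realises_density W"
        using realises_density_locally[OF _ ne] closed_closure by blast
      then have "W \<inter> \<Union>\<U> = {}"
        using sub by blast
      moreover have "W \<in> \<U> \<or> (\<exists>V\<in>\<U>. W \<inter> V \<noteq> {})"
        using max W(1,4) by (auto simp: disjnt_def Int_commute)
      ultimately show False
        using W(2) by blast
    qed
    then show "closure (\<Union>U\<in>\<U>. E U) = UNIV"
      by blast
  qed
qed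

text \<open>
  No discrete set exceeds the density, because the points of a dense set that are chosen in small
  balls around its points are distinct.
\<close>

lemma discrete_subset_of_density_size:
  obtains D :: "'a::metric_space set"
  where "discrete D" "|D| =o topological_density (euclidean :: 'a topology)"
proof -
  obtain D E :: "'a set" where DE: "discrete D" "closure E = UNIV" "|E| \<le>o |D|"
    by (rule discrete_subset_realises_density)
  have "dense_subset euclidean E"
    using DE(2) by (simp add: dense_subset_def)
  then have ge: "topological_density (euclidean :: 'a topology) \<le>o |D|"
    using topological_density(2) DE(3) ordLeq_transitive by blast
  obtain F :: "'a set" where F: "dense_subset euclidean F" "topological_density (euclidean :: 'a topology) = |F|"
    using topological_density(1) by blast
  have "\<exists>r>0. \<forall>y\<in>D. dist x y < r \<longrightarrow> y = x" if "x \<in> D" for x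
    using DE(1) that by (auto simp: discrete_def isolated_in_dist_Ex_iff)
  then obtain r where r: "\<And>x. x \<in> D \<Longrightarrow> r x > 0" "\<And>x y. x \<in> D \<Longrightarrow> y \<in> D \<Longrightarrow> dist x y < r x \<Longrightarrow> y = x"
    by metis
  have "\<exists>y\<in>F. dist y x < r x / 2" if "x \<in> D" for x
  proof -
    have "x \<in> closure F"
      using F(1) by (simp add: dense_subset_def)
    moreover have "r x / 2 > 0"
      using r(1)[OF that] by simp
    ultimately show ?thesis
      unfolding closure_approachable by blast
  qed
  then obtain p where p: "\<And>x. x \<in> D \<Longrightarrow> p x \<in> F" "\<And>x. x \<in> D \<Longrightarrow> dist (p x) x < r x / 2"
    by metis
  have "inj_on p D"
  proof (rule inj_onI)
    fix x y assume xy: "x \<in> D" "y \<in> D" "p x = p y"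
    then have "dist x y < max (r x) (r y)"
      using p(2)[of x] p(2)[of y] dist_triangle3[of x y "p x"] by auto
    then show "x = y"
      using r(2)[of x y] r(2)[of y x] xy by (auto simp: dist_commute max_def split: if_splits)
  qed
  then have "|D| \<le>o |F|"
    using p(1) by (auto simp flip: card_of_ordLeq)
  with ge F(2) DE(1) that show ?thesis
    by (simp add: ordIso_iff_ordLeq)
qed

section \<open>Difference quotients that interpolate bounded families\<close>

text \<open>
  The balls of radius \<open>r x\<close> around the points \<open>x\<close> of \<open>S\<close> are disjoint, the partners \<open>y x\<close> lie
  outside all of them, and the distance from \<open>x\<close> to its partner is comparable with the radius.  The
  cone of height \<open>r x\<close> on the ball around \<open>x\<close> then has a difference quotient of at least \<open>1 / 4\<close>
  between \<open>x\<close> and \<open>y x\<close>, and vanishes at all other points of \<open>S\<close> and at all partners.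
\<close>

definition bump_system ::
  "'a::metric_space set \<Rightarrow> ('a \<Rightarrow> real) \<Rightarrow> ('a \<Rightarrow> 'a) \<Rightarrow> bool" where
  "bump_system S r y \<longleftrightarrow>
     (\<forall>x\<in>S. 0 < r x \<and> y x \<noteq> x \<and> dist x (y x) \<le> 4 * r x) \<and>
     (\<forall>x\<in>S. \<forall>x'\<in>S. x \<noteq> x' \<longrightarrow> r x + r x' \<le> dist x x') \<and>
     (\<forall>x\<in>S. \<forall>x'\<in>S. r x \<le> dist (y x') x)"

text \<open>
  Join each \<open>x\<close> to \<open>\<beta> x\<close>, and let \<open>S\<close> be a maximal independent set of this graph.  A point outside
  \<open>S\<close> lies in the image of \<open>S\<close>, which is no larger than \<open>S\<close>, or in the set \<open>N\<close> of points mapped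
  into \<open>S\<close>.  But \<open>N\<close> is disjoint from \<open>S\<close> and hence independent too, and one of \<open>S\<close> and \<open>N\<close> has to be
  as large as \<open>D\<close>.
\<close>

lemma large_independent_subset:
  fixes \<beta> :: "'a \<Rightarrow> 'a"
  assumes "infinite D"
  obtains S where "S \<subseteq> D" "|S| =o |D|" "\<And>x x'. x \<in> S \<Longrightarrow> x' \<in> S \<Longrightarrow> x \<noteq> x' \<Longrightarrow> \<beta> x \<noteq> x'"
proof -
  obtain S where S: "S \<subseteq> D" "pairwise (\<lambda>x x'. \<beta> x \<noteq> x') S"
    and max: "\<forall>x\<in>D. x \<notin> S \<longrightarrow> (\<exists>x'\<in>S. \<not> \<beta> x \<noteq> x' \<or> \<not> \<beta> x' \<noteq> x)"
    using maximal_pairwise[of D "\<lambda>x x'. \<beta> x \<noteq> x'"] by (elim exE conjE)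
  define N where "N = {x \<in> D - S. \<beta> x \<in> S}"
  have cover: "D \<subseteq> (S \<union> \<beta> ` S) \<union> N"
    using max by (auto simp: N_def)
  have indepN: "\<beta> x \<noteq> x'" if "x \<in> N" "x' \<in> N" for x x'
    using that by (auto simp: N_def)
  have indepS: "\<beta> x \<noteq> x'" if "x \<in> S" "x' \<in> S" "x \<noteq> x'" for x x'
    using S(2) that by (auto simp: pairwise_def)
  have "|D| \<le>o |S| \<or> |D| \<le>o |N|"
  proof (rule ccontr)
    assume "\<not> ?thesis"
    then have lt: "|S| <o |D|" "|N| <o |D|"
      by (simp_all add: not_ordLeq_iff_ordLess[OF card_of_Well_order card_of_Well_order])
    have "|\<beta> ` S| <o |D|"
      using card_of_image lt(1) by (rule ordLeq_ordLess_trans)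
    then have "|(S \<union> \<beta> ` S) \<union> N| <o |D|"
      using assms lt by (intro card_of_Un_ordLess_infinite)
    then show False
      using card_of_mono1[OF cover] not_ordLess_ordLeq by blast
  qed
  then show thesis
  proof
    assume "|D| \<le>o |S|"
    with card_of_mono1[OF S(1)] have "|S| =o |D|"
      by (simp add: ordIso_iff_ordLeq)
    then show thesis
      using that[OF S(1)] indepS by simp
  next
    assume "|D| \<le>o |N|"
    moreover have "N \<subseteq> D"
      by (auto simp: N_def)
    ultimately have "|N| =o |D|"
      using card_of_mono1[of N D] by (simp add: ordIso_iff_ordLeq)
    then show thesis
      using that[OF \<open>N \<subseteq> D\<close>] indepN by simp
  qed
qed

text \<open>
  Let \<open>R x\<close> be the distance from \<open>x\<close> to the rest of \<open>D\<close>.  The radius is \<open>R x / 2\<close>, which makes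
  the balls disjoint, and the partner is a point of \<open>D\<close> at distance less than \<open>2 * R x\<close>.  A partner
  must not be the centre of a ball, which is achieved by an independent subset of \<open>D\<close>.
\<close>

lemma bump_system_exists:
  fixes D :: "'a::metric_space set"
  assumes "discrete D" "infinite D"
  obtains S :: "'a set" and r y where "|S| =o |D|" "bump_system S r y"
proof -
  define R where "R x = infdist x (D - {x})" for x
  have ne: "D - {x} \<noteq> {}" for x
    using assms(2) by (metis finite.emptyI finite_insert infinite_remove)
  have R_le: "R x \<le> dist x z" if "z \<in> D" "z \<noteq> x" for x z
    using that by (simp add: R_def infdist_le)
  have R_pos: "0 < R x" if "x \<in> D" for x
  proof -
    have "x isolated_in D"
      using assms(1) that by (rule discreteD)
    then obtain d where d: "d > 0" "\<forall>z\<in>D. dist x z < d \<longrightarrow> z = x"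
      unfolding isolated_in_dist_Ex_iff by blast
    have "d \<le> R x"
      unfolding R_def infdist_notempty[OF ne] using d(2) ne by (intro cINF_greatest) force+
    with d(1) show ?thesis
      by linarith
  qed
  have "\<exists>z\<in>D - {x}. dist x z < 2 * R x" if "x \<in> D" for x
  proof -
    have "Inf (dist x ` (D - {x})) < 2 * R x"
      using R_pos[OF that] by (simp add: R_def infdist_notempty[OF ne])
    then show ?thesis
      using cInf_lessD[of "dist x ` (D - {x})"] ne by blast
  qed
  then have "\<forall>x\<in>D. \<exists>z. z \<in> D \<and> z \<noteq> x \<and> dist x z < 2 * R x"
    by blast
  from bchoice[OF this] obtain \<beta> where "\<forall>x\<in>D. \<beta> x \<in> D \<and> \<beta> x \<noteq> x \<and> dist x (\<beta> x) < 2 * R x"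
    by (rule exE)
  then have \<beta>: "\<beta> x \<in> D" "\<beta> x \<noteq> x" "dist x (\<beta> x) < 2 * R x" if "x \<in> D" for x
    using that by simp_all
  obtain S where S: "S \<subseteq> D" "|S| =o |D|" "\<And>x x'. x \<in> S \<Longrightarrow> x' \<in> S \<Longrightarrow> x \<noteq> x' \<Longrightarrow> \<beta> x \<noteq> x'"
    using large_independent_subset[OF assms(2)] by metis
  have "bump_system S (\<lambda>x. R x / 2) \<beta>"
    unfolding bump_system_def
  proof (intro conjI ballI impI)
    fix x assume x: "x \<in> S"
    then have xD: "x \<in> D"
      using S(1) by blast
    show "0 < R x / 2" "\<beta> x \<noteq> x" "dist x (\<beta> x) \<le> 4 * (R x / 2)"
      using R_pos[OF xD] \<beta>(2,3)[OF xD] by simp_all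
    fix x' assume x': "x' \<in> S"
    then have xD': "x' \<in> D"
      using S(1) by blast
    show "R x / 2 + R x' / 2 \<le> dist x x'" if "x \<noteq> x'"
      using R_le[of x' x] R_le[of x x'] xD xD' that by (simp add: dist_commute)
    have "\<beta> x' \<noteq> x"
      using S(3)[OF x' x] \<beta>(2)[OF xD'] by (cases "x' = x") simp_all
    then show "R x / 2 \<le> dist (\<beta> x') x"
      using R_le[OF \<beta>(1)[OF xD'], of x] R_pos[OF xD] by (simp add: dist_commute)
  qed
  with S(2) that show ?thesis
    by blast
qed

text \<open>
  On the ball around \<open>x\<close> the function is the multiple of the cone \<open>r x - dist z x\<close> that produces
  the difference quotient \<open>a x\<close>; elsewhere it is \<open>0\<close>.  The slopes are bounded, because partners are
  not much further away than the radius.  For \<open>z\<close> and \<open>w\<close> in different balls, the value at \<open>z\<close> is at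
  most the slope times \<open>dist z w\<close>, since the cone around \<open>z\<close> vanishes at \<open>w\<close>, and symmetrically;
  so the Lipschitz constant at most doubles.  Subtracting the value at \<open>e\<close> changes no difference
  quotient.
\<close>

lemma Lip0_interpolation:
  fixes a :: "'a::metric_space \<Rightarrow> real"
  assumes sys: "bump_system S r y" and "bounded (a ` S)"
  obtains f where "f \<in> Lip0 e" "\<And>x. x \<in> S \<Longrightarrow> (f x - f (y x)) / dist x (y x) = a x"
proof -
  have r: "0 < r x" "y x \<noteq> x" "dist x (y x) \<le> 4 * r x" if "x \<in> S" for x
    using sys that by (simp_all add: bump_system_def)
  have apart: "r x + r x' \<le> dist x x'" if "x \<in> S" "x' \<in> S" "x \<noteq> x'" for x x'
    using sys that by (simp add: bump_system_def)
  have avoid: "r x \<le> dist (y x') x" if "x \<in> S" "x' \<in> S" for x x'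
    using sys that by (simp add: bump_system_def)
  obtain C where C: "C > 0" "\<And>x. x \<in> S \<Longrightarrow> \<bar>a x\<bar> \<le> C"
    using assms(2) by (auto simp: bounded_pos)
  define c where "c x = a x * dist x (y x) / r x" for x
  have c_bound: "\<bar>c x\<bar> \<le> 4 * C" if "x \<in> S" for x
  proof -
    have "\<bar>a x\<bar> * dist x (y x) \<le> C * (4 * r x)"
      using C r[OF that] that by (intro mult_mono) auto
    then show ?thesis
      using r(1)[OF that] by (simp add: c_def abs_mult divide_le_eq)
  qed
  have unique: "x = x'" if "x \<in> S" "x' \<in> S" "dist z x < r x" "dist z x' < r x'" for z x x'
    using apart[OF that(1,2)] that(3,4) dist_triangle3[of x x' z] by force
  have "\<exists>v. (\<forall>x\<in>S. dist z x < r x \<longrightarrow> v = c x * (r x - dist z x)) \<and>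
      ((\<forall>x\<in>S. r x \<le> dist z x) \<longrightarrow> v = 0)" for z
  proof (cases "\<exists>x\<in>S. dist z x < r x")
    case True
    then obtain x where x: "x \<in> S" "dist z x < r x"
      by blast
    show ?thesis
    proof (intro exI conjI ballI impI)
      show "c x * (r x - dist z x) = c x' * (r x' - dist z x')" if "x' \<in> S" "dist z x' < r x'" for x'
        using unique[OF x(1) that(1) x(2) that(2)] by simp
      show "c x * (r x - dist z x) = 0" if "\<forall>x\<in>S. r x \<le> dist z x"
        using that x by auto
    qed
  next
    case False
    then show ?thesis
      by (intro exI[of _ 0]) auto
  qed
  then have "\<exists>g. \<forall>z. (\<forall>x\<in>S. dist z x < r x \<longrightarrow> g z = c x * (r x - dist z x)) \<and>
      ((\<forall>x\<in>S. r x \<le> dist z x) \<longrightarrow> g z = 0)"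
    by (intro choice allI)
  then obtain g where g: "\<And>z x. x \<in> S \<Longrightarrow> dist z x < r x \<Longrightarrow> g z = c x * (r x - dist z x)"
    "\<And>z. (\<forall>x\<in>S. r x \<le> dist z x) \<Longrightarrow> g z = 0"
    by auto
  have outside: "\<bar>g z\<bar> \<le> 4 * C * dist z w" if "x \<in> S" "dist z x < r x" "r x \<le> dist w x" for z w x
  proof -
    have "\<bar>g z\<bar> = \<bar>c x\<bar> * (r x - dist z x)"
      using g(1)[OF that(1,2)] that(2) by (simp add: abs_mult)
    also have "\<dots> \<le> (4 * C) * dist z w"
      using c_bound[OF that(1)] C(1) that(2,3) dist_triangle3[of w x z]
      by (intro mult_mono) (auto simp: dist_commute)
    finally show ?thesis .
  qed
  have lip: "\<bar>g z - g w\<bar> \<le> 8 * C * dist z w" for z w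
  proof -
    have pos: "0 \<le> C * dist z w"
      using C(1) by simp
    consider (same) x where "x \<in> S" "dist z x < r x" "dist w x < r x"
      \<comment> \<open>Either point may also lie in no ball at all.\<close>
      | (diff) "\<forall>x\<in>S. dist z x < r x \<longrightarrow> r x \<le> dist w x" "\<forall>x\<in>S. dist w x < r x \<longrightarrow> r x \<le> dist z x"
      by (metis not_le)
    then show ?thesis
    proof cases
      case same
      have "g z - g w = c x * (dist w x - dist z x)"
        using g(1)[OF same(1,2)] g(1)[OF same(1,3)] by (simp add: algebra_simps)
      then have "\<bar>g z - g w\<bar> = \<bar>c x\<bar> * \<bar>dist w x - dist z x\<bar>"
        by (simp add: abs_mult)
      also have "\<dots> \<le> (4 * C) * dist z w"
        using c_bound[OF same(1)] C(1) abs_dist_diff_le[of w x z]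
        by (intro mult_mono) (auto simp: dist_commute)
      finally show ?thesis
        using pos by linarith
    next
      case diff
      have half: "\<bar>g u\<bar> \<le> 4 * C * dist u v" if "\<forall>x\<in>S. dist u x < r x \<longrightarrow> r x \<le> dist v x" for u v
      proof (cases "\<exists>x\<in>S. dist u x < r x")
        case True
        then show ?thesis
          using that outside by blast
      next
        case False
        then have "g u = 0"
          by (intro g(2)) (simp add: not_less)
        then show ?thesis
          using C(1) by simp
      qed
      show ?thesis
        using half[OF diff(1)] half[OF diff(2)] by (simp add: dist_commute)
    qed
  qed
  define f where "f z = g z - g e" for z
  have "f \<in> Lip0 e"
    unfolding Lip0_def
  proof (intro CollectI conjI exI)
    show "(8 * C)-lipschitz_on UNIV f"
      using lip C(1) by (intro lipschitz_onI) (auto simp: f_def dist_real_def)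
  qed (simp add: f_def)
  moreover have "(f x - f (y x)) / dist x (y x) = a x" if "x \<in> S" for x
  proof -
    have "g (y x) = 0"
      using avoid that by (intro g(2)) blast
    moreover have "g x = a x * dist x (y x)"
      using g(1)[OF that, of x] r(1)[OF that] by (simp add: c_def)
    ultimately show ?thesis
      using r(2)[OF that] by (simp add: f_def)
  qed
  ultimately show ?thesis
    using that by blast
qed

section \<open>The space of ultrafilters on a set\<close>

definition ultrafilters :: "'a set \<Rightarrow> 'a set set set" where
  "ultrafilters S = {F. F \<subseteq> Pow S \<and> {} \<notin> F \<and> (\<forall>A\<in>F. \<forall>B\<in>F. A \<inter> B \<in> F) \<and>
     (\<forall>A\<in>F. \<forall>B. A \<subseteq> B \<longrightarrow> B \<subseteq> S \<longrightarrow> B \<in> F) \<and> (\<forall>A\<subseteq>S. A \<in> F \<or> S - A \<in> F)}"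

definition ultrafilters_containing :: "'a set \<Rightarrow> 'a set \<Rightarrow> 'a set set set" where
  "ultrafilters_containing S A = {F \<in> ultrafilters S. A \<in> F}"

definition principal_ultrafilter :: "'a set \<Rightarrow> 'a \<Rightarrow> 'a set set" where
  "principal_ultrafilter S x = {A. A \<subseteq> S \<and> x \<in> A}"

text \<open>
  The topology generated by the sets \<open>ultrafilters_containing S A\<close>.  It is the Stone-Cech
  compactification of \<open>S\<close> as a discrete space.
\<close>

definition stone_cech :: "'a set \<Rightarrow> 'a set set topology" where
  "stone_cech S = topology (\<lambda>U. U \<subseteq> ultrafilters S \<and>
     (\<forall>F\<in>U. \<exists>A\<in>F. ultrafilters_containing S A \<subseteq> U))"

lemma ultrafilters_Int:
  assumes "F \<in> ultrafilters S" "A \<in> F" "B \<in> F"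
  shows "A \<inter> B \<in> F"
  using assms by (simp add: ultrafilters_def)

lemma ultrafilters_subset:
  assumes "F \<in> ultrafilters S" "A \<in> F"
  shows "A \<subseteq> S"
  using assms by (auto simp: ultrafilters_def)

lemma ultrafilters_nonempty:
  assumes "F \<in> ultrafilters S" "A \<in> F"
  shows "A \<noteq> {}"
  using assms by (auto simp: ultrafilters_def)

lemma ultrafilters_mono:
  assumes "F \<in> ultrafilters S" "A \<in> F" "A \<subseteq> B" "B \<subseteq> S"
  shows "B \<in> F"
  using assms by (auto simp: ultrafilters_def)

lemma ultrafilters_Diff_iff:
  assumes "F \<in> ultrafilters S" "A \<subseteq> S"
  shows "S - A \<in> F \<longleftrightarrow> A \<notin> F"
proof
  assume "S - A \<in> F"
  moreover have "(S - A) \<inter> A = {}"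
    by blast
  ultimately show "A \<notin> F"
    using ultrafilters_Int[OF assms(1), of "S - A" A] ultrafilters_nonempty[OF assms(1), of "{}"] by auto
next
  have "\<forall>A\<subseteq>S. A \<in> F \<or> S - A \<in> F"
    using assms(1) by (simp add: ultrafilters_def)
  moreover assume "A \<notin> F"
  ultimately show "S - A \<in> F"
    using assms(2) by blast
qed

lemma ultrafilters_top:
  assumes "F \<in> ultrafilters S"
  shows "S \<in> F"
  using ultrafilters_Diff_iff[OF assms, of "{}"] ultrafilters_nonempty[OF assms] by auto

lemma principal_ultrafilter: "x \<in> S \<Longrightarrow> principal_ultrafilter S x \<in> ultrafilters S"
  by (auto simp: principal_ultrafilter_def ultrafilters_def)

lemma ultrafilters_containing_inj:
  assumes "A \<subseteq> S" "B \<subseteq> S" "ultrafilters_containing S A = ultrafilters_containing S B"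
  shows "A = B"
proof -
  have "x \<in> A \<longleftrightarrow> principal_ultrafilter S x \<in> ultrafilters_containing S A"
    if "x \<in> S" "A \<subseteq> S" for x A
    using that principal_ultrafilter[OF that(1)]
    by (simp add: ultrafilters_containing_def principal_ultrafilter_def)
  with assms show ?thesis
    by blast
qed

text \<open>
  A maximal filter base \<open>F\<close> above \<open>G\<close> contains every set \<open>A\<close> that meets all of its members, since
  the traces of the members on \<open>A\<close> could be added to it.  Both upward closure and the choice between
  \<open>A\<close> and \<open>S - A\<close> follow from this.
\<close>

lemma ultrafilter_extension:
  assumes "G \<subseteq> Pow S" "S \<in> G" "{} \<notin> G" and "\<And>A B. A \<in> G \<Longrightarrow> B \<in> G \<Longrightarrow> A \<inter> B \<in> G"
  obtains F where "F \<in> ultrafilters S" "G \<subseteq> F"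
proof -
  define P where "P = {F. F \<subseteq> Pow S \<and> G \<subseteq> F \<and> {} \<notin> F \<and> (\<forall>A\<in>F. \<forall>B\<in>F. A \<inter> B \<in> F)}"
  have "\<exists>F\<in>P. \<forall>X\<in>P. F \<subseteq> X \<longrightarrow> X = F"
  proof (rule subset_Zorn_nonempty)
    have "G \<in> P"
      using assms by (simp add: P_def)
    then show "P \<noteq> {}"
      by blast
    fix C assume C: "C \<noteq> {}" "subset.chain P C"
    then have CP: "C \<subseteq> P" and lin: "\<And>X Y. X \<in> C \<Longrightarrow> Y \<in> C \<Longrightarrow> X \<subseteq> Y \<or> Y \<subseteq> X"
      by (auto simp: subset_chain_def)
    have "A \<inter> B \<in> \<Union>C" if AB: "A \<in> \<Union>C" "B \<in> \<Union>C" for A B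
    proof -
      obtain X Y where XY: "X \<in> C" "A \<in> X" "Y \<in> C" "B \<in> Y"
        using AB by blast
      define Z where "Z = (if X \<subseteq> Y then Y else X)"
      have Z: "Z \<in> C" "A \<in> Z" "B \<in> Z"
        using XY lin[of X Y] by (auto simp: Z_def)
      then have "A \<inter> B \<in> Z"
        using CP by (auto simp: P_def)
      with Z(1) show ?thesis
        by blast
    qed
    moreover have X: "X \<subseteq> Pow S" "G \<subseteq> X" "{} \<notin> X" if "X \<in> C" for X
      using subsetD[OF CP that] by (simp_all add: P_def)
    have "\<Union>C \<subseteq> Pow S" "{} \<notin> \<Union>C"
      using X(1) by (rule Union_least) (use X(3) in auto)
    moreover have "G \<subseteq> \<Union>C"
      using C(1) X(2) by (meson Union_upper equals0I order_trans)
    ultimately show "\<Union>C \<in> P"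
      by (simp add: P_def)
  qed
  then obtain F where "F \<in> P" and max: "\<And>X. X \<in> P \<Longrightarrow> F \<subseteq> X \<Longrightarrow> X = F"
    by blast
  then have F: "F \<subseteq> Pow S" "G \<subseteq> F" "{} \<notin> F" "\<And>A B. A \<in> F \<Longrightarrow> B \<in> F \<Longrightarrow> A \<inter> B \<in> F"
    by (auto simp: P_def)
  have meets: "A \<in> F" if A: "A \<subseteq> S" and ne: "\<And>B. B \<in> F \<Longrightarrow> B \<inter> A \<noteq> {}" for A
  proof -
    define X where "X = F \<union> (\<lambda>B. B \<inter> A) ` F"
    \<comment> \<open>Brings intersections of members of \<open>X\<close> into the shape of members.\<close>
    have int: "(B \<inter> A) \<inter> C = (B \<inter> C) \<inter> A" "C \<inter> (B \<inter> A) = (C \<inter> B) \<inter> A"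
      "(B \<inter> A) \<inter> (C \<inter> A) = (B \<inter> C) \<inter> A" for B C
      by blast+
    have "X \<in> P"
      unfolding P_def
    proof (intro CollectI conjI ballI)
      show "X \<subseteq> Pow S" "G \<subseteq> X"
        using F A by (auto simp: X_def)
      show "{} \<notin> X"
        using F(3) ne by (auto simp: X_def)
      show "B \<inter> C \<in> X" if "B \<in> X" "C \<in> X" for B C
        using that F(4) unfolding X_def by (auto simp: int)
    qed
    then have "X = F"
      by (rule max) (simp add: X_def)
    moreover have "S \<inter> A \<in> X"
      using F(2) assms(2) by (auto simp: X_def)
    ultimately show ?thesis
      using A by (simp add: Int_absorb1)
  qed
  have "F \<in> ultrafilters S"
    unfolding ultrafilters_def
  proof (intro CollectI conjI ballI allI impI)
    show "B \<in> F" if "A \<in> F" "A \<subseteq> B" "B \<subseteq> S" for A B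
    proof (rule meets[OF that(3)])
      show "C \<inter> B \<noteq> {}" if "C \<in> F" for C
        using F(3) F(4)[OF that \<open>A \<in> F\<close>] \<open>A \<subseteq> B\<close> by (metis Int_mono bot.extremum_uniqueI order_refl)
    qed
    show "A \<in> F \<or> S - A \<in> F" if "A \<subseteq> S" for A
    proof (cases "\<forall>B\<in>F. B \<inter> A \<noteq> {}")
      case True
      then show ?thesis
        using meets[OF that] by blast
    next
      case False
      then obtain B where B: "B \<in> F" "B \<inter> A = {}"
        by blast
      have "C \<inter> (S - A) \<noteq> {}" if "C \<in> F" for C
      proof -
        have "C \<inter> B \<noteq> {}" "B \<subseteq> S"
          using F(1) F(3) F(4)[OF that B(1)] B(1) by auto
        with B(2) show ?thesis
          by blast
      qed
      then show ?thesis
        using meets[of "S - A"] by blast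
    qed
  qed (use F in auto)
  with F(2) that show ?thesis
    by blast
qed

lemma openin_stone_cech:
  "openin (stone_cech S) U \<longleftrightarrow>
     U \<subseteq> ultrafilters S \<and> (\<forall>F\<in>U. \<exists>A\<in>F. ultrafilters_containing S A \<subseteq> U)"
proof -
  let ?open = "\<lambda>U. U \<subseteq> ultrafilters S \<and> (\<forall>F\<in>U. \<exists>A\<in>F. ultrafilters_containing S A \<subseteq> U)"
  have "istopology ?open"
    unfolding istopology_def
  proof (intro conjI allI impI)
    fix U V assume UV: "?open U" "?open V"
    have "\<exists>C\<in>F. ultrafilters_containing S C \<subseteq> U \<inter> V" if F: "F \<in> U \<inter> V" for F
    proof -
      obtain A where A: "A \<in> F" "ultrafilters_containing S A \<subseteq> U"
        using F UV(1) by blast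
      obtain B where B: "B \<in> F" "ultrafilters_containing S B \<subseteq> V"
        using F UV(2) by blast
      have FS: "F \<in> ultrafilters S"
        using F UV by blast
      have "A \<subseteq> S" "B \<subseteq> S"
        using ultrafilters_subset[OF FS] A(1) B(1) by simp_all
      then have "ultrafilters_containing S (A \<inter> B) \<subseteq> ultrafilters_containing S A"
        "ultrafilters_containing S (A \<inter> B) \<subseteq> ultrafilters_containing S B"
        by (auto simp: ultrafilters_containing_def intro: ultrafilters_mono)
      with A(2) B(2) have "ultrafilters_containing S (A \<inter> B) \<subseteq> U \<inter> V"
        by (meson Int_greatest order_trans)
      then show ?thesis
        using ultrafilters_Int[OF FS A(1) B(1)] by (rule bexI)
    qed
    then show "\<forall>F\<in>U \<inter> V. \<exists>A\<in>F. ultrafilters_containing S A \<subseteq> U \<inter> V"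
      by blast
    show "U \<inter> V \<subseteq> ultrafilters S"
      using UV by blast
  next
    fix \<U> assume "\<forall>U\<in>\<U>. ?open U"
    then show "\<Union>\<U> \<subseteq> ultrafilters S" "\<forall>F\<in>\<Union>\<U>. \<exists>A\<in>F. ultrafilters_containing S A \<subseteq> \<Union>\<U>"
      by (blast, meson UnionE Union_upper subset_trans)
  qed
  then show ?thesis
    by (simp add: stone_cech_def)
qed

lemma topspace_stone_cech [simp]: "topspace (stone_cech S) = ultrafilters S"
proof
  show "topspace (stone_cech S) \<subseteq> ultrafilters S"
    using openin_topspace openin_stone_cech by blast
  have "openin (stone_cech S) (ultrafilters S)"
    using ultrafilters_top by (fastforce simp: openin_stone_cech ultrafilters_containing_def)
  then show "ultrafilters S \<subseteq> topspace (stone_cech S)"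
    by (rule openin_subset)
qed

lemma stone_cech_nhdE:
  assumes "openin (stone_cech S) U" "F \<in> U"
  obtains A where "A \<in> F" "A \<subseteq> S" "ultrafilters_containing S A \<subseteq> U" "F \<in> ultrafilters S"
proof -
  have F: "F \<in> ultrafilters S"
    using assms openin_subset by fastforce
  obtain A where "A \<in> F" "ultrafilters_containing S A \<subseteq> U"
    using assms unfolding openin_stone_cech by blast
  with F that show ?thesis
    using ultrafilters_subset by blast
qed

lemma principal_ultrafilter_in_containing:
  assumes "A \<subseteq> S" "x \<in> A"
  shows "principal_ultrafilter S x \<in> ultrafilters_containing S A"
  using assms principal_ultrafilter[of x S]
  by (auto simp: ultrafilters_containing_def principal_ultrafilter_def)

lemma openin_ultrafilters_containing: "openin (stone_cech S) (ultrafilters_containing S A)"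
  by (auto simp: openin_stone_cech ultrafilters_containing_def)

lemma ultrafilters_containing_Diff:
  "A \<subseteq> S \<Longrightarrow> ultrafilters_containing S (S - A) = ultrafilters S - ultrafilters_containing S A"
  using ultrafilters_Diff_iff by (auto simp: ultrafilters_containing_def)

lemma closedin_ultrafilters_containing:
  assumes "A \<subseteq> S"
  shows "closedin (stone_cech S) (ultrafilters_containing S A)"
proof -
  have "ultrafilters_containing S A \<subseteq> ultrafilters S"
    by (auto simp: ultrafilters_containing_def)
  then show ?thesis
    using openin_ultrafilters_containing[of S "S - A"]
    by (simp add: closedin_def ultrafilters_containing_Diff[OF assms])
qed

lemma Hausdorff_space_stone_cech: "Hausdorff_space (stone_cech S)"
  unfolding Hausdorff_space_def topspace_stone_cech
proof (intro allI impI, elim conjE)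
  have sep: "\<exists>U V. openin (stone_cech S) U \<and> openin (stone_cech S) V \<and> F \<in> U \<and> G \<in> V \<and> disjnt U V"
    if "F \<in> ultrafilters S" "G \<in> ultrafilters S" "A \<in> F" "A \<notin> G" for F G A
  proof (intro exI conjI)
    have A: "A \<subseteq> S"
      using that ultrafilters_subset by blast
    show "F \<in> ultrafilters_containing S A" "G \<in> ultrafilters_containing S (S - A)"
      using that ultrafilters_Diff_iff[OF that(2) A] by (auto simp: ultrafilters_containing_def)
    show "disjnt (ultrafilters_containing S A) (ultrafilters_containing S (S - A))"
      by (auto simp: disjnt_def ultrafilters_containing_Diff[OF A])
  qed (rule openin_ultrafilters_containing)+
  fix F G assume FG: "F \<in> ultrafilters S" "G \<in> ultrafilters S" "F \<noteq> G"
  then consider A where "A \<in> F" "A \<notin> G" | A where "A \<in> G" "A \<notin> F"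
    by blast
  then show "\<exists>U V. openin (stone_cech S) U \<and> openin (stone_cech S) V \<and> F \<in> U \<and> G \<in> V \<and> disjnt U V"
  proof cases
    case (1 A)
    then show ?thesis
      using sep FG by blast
  next
    case (2 A)
    then show ?thesis
      using sep[of G F A] FG by (meson disjnt_sym)
  qed
qed

text \<open>
  Suppose that a cover has no finite subcover.  The complements of those sets \<open>A\<close> for which
  \<open>ultrafilters_containing S A\<close> is finitely covered form a filter base, and an ultrafilter above it is
  not covered: a basic neighbourhood inside a member of the cover is itself finitely covered.
\<close>

lemma compact_space_stone_cech: "compact_space (stone_cech S)"
proof -
  have "\<exists>\<F>. finite \<F> \<and> \<F> \<subseteq> \<U> \<and> ultrafilters S \<subseteq> \<Union>\<F>"
    if open_cover: "\<forall>U\<in>\<U>. openin (stone_cech S) U" and cover: "ultrafilters S \<subseteq> \<Union>\<U>" for \<U>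
  proof (rule ccontr)
    assume no: "\<not> ?thesis"
    define G where "G = {A. A \<subseteq> S \<and>
      (\<exists>\<F>. finite \<F> \<and> \<F> \<subseteq> \<U> \<and> ultrafilters_containing S (S - A) \<subseteq> \<Union>\<F>)}"
    have "ultrafilters_containing S S = ultrafilters S"
      using ultrafilters_top by (auto simp: ultrafilters_containing_def)
    then have "{} \<notin> G"
      using no by (auto simp: G_def)
    have "ultrafilters_containing S {} = {}"
      using ultrafilters_nonempty by (auto simp: ultrafilters_containing_def)
    then have "S \<in> G"
      by (auto simp: G_def)
    have "A \<inter> B \<in> G" if AB: "A \<in> G" "B \<in> G" for A B
    proof -
      obtain \<A> \<B> where fin: "finite \<A>" "\<A> \<subseteq> \<U>" "ultrafilters_containing S (S - A) \<subseteq> \<Union>\<A>"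
        "finite \<B>" "\<B> \<subseteq> \<U>" "ultrafilters_containing S (S - B) \<subseteq> \<Union>\<B>"
        using AB by (auto simp: G_def)
      have sub: "A \<subseteq> S" "B \<subseteq> S"
        using AB by (auto simp: G_def)
      have "ultrafilters_containing S (S - A \<inter> B)
          \<subseteq> ultrafilters_containing S (S - A) \<union> ultrafilters_containing S (S - B)"
        using sub ultrafilters_Int[of _ S A B]
        by (auto simp: ultrafilters_containing_Diff le_infI1) (auto simp: ultrafilters_containing_def)
      then have "ultrafilters_containing S (S - A \<inter> B) \<subseteq> \<Union>(\<A> \<union> \<B>)"
        using fin by blast
      moreover have "finite (\<A> \<union> \<B>)" "\<A> \<union> \<B> \<subseteq> \<U>"
        using fin by auto
      ultimately show ?thesis
        using sub unfolding G_def by blast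
    qed
    then obtain F where F: "F \<in> ultrafilters S" "G \<subseteq> F"
      using \<open>{} \<notin> G\<close> \<open>S \<in> G\<close> by (rule_tac ultrafilter_extension[of G S]) (auto simp: G_def)
    then obtain U where U: "U \<in> \<U>" "F \<in> U"
      using cover by blast
    then obtain A where A: "A \<in> F" "ultrafilters_containing S A \<subseteq> U" and "A \<subseteq> S"
      using open_cover by (meson stone_cech_nhdE)
    then have "S - (S - A) = A"
      by blast
    then have "S - A \<in> G"
      using A U unfolding G_def by (auto intro!: exI[of _ "{U}"])
    then show False
      using F A ultrafilters_Diff_iff[OF F(1) \<open>A \<subseteq> S\<close>] by blast
  qed
  then show ?thesis
    by (simp add: compact_space_def compactin_def)
qed

text \<open>
  The principal ultrafilters are dense, so the closure of an open set \<open>U\<close> is determined by the set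
  \<open>A\<close> of points whose principal ultrafilters lie in \<open>U\<close>: it is the clopen set belonging to \<open>A\<close>.
\<close>

lemma extremally_disconnected_stone_cech: "extremally_disconnected (stone_cech S)"
  unfolding extremally_disconnected_def
proof (intro allI impI)
  fix U assume U: "openin (stone_cech S) U"
  define A where "A = {x \<in> S. principal_ultrafilter S x \<in> U}"
  have "A \<subseteq> S"
    by (auto simp: A_def)
  have "U \<subseteq> ultrafilters_containing S A"
  proof
    fix F assume "F \<in> U"
    with U obtain B where B: "B \<in> F" "B \<subseteq> S" "ultrafilters_containing S B \<subseteq> U"
      and F: "F \<in> ultrafilters S"
      by (rule stone_cech_nhdE)
    have "principal_ultrafilter S x \<in> U" if "x \<in> B" for x
      using principal_ultrafilter_in_containing[OF B(2) that] B(3) by blast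
    with B(2) have "B \<subseteq> A"
      by (auto simp: A_def)
    then show "F \<in> ultrafilters_containing S A"
      using B(1) F \<open>A \<subseteq> S\<close> ultrafilters_mono by (auto simp: ultrafilters_containing_def)
  qed
  then have "stone_cech S closure_of U \<subseteq> ultrafilters_containing S A"
    using closedin_ultrafilters_containing[OF \<open>A \<subseteq> S\<close>] by (rule closure_of_minimal)
  moreover have "ultrafilters_containing S A \<subseteq> stone_cech S closure_of U"
  proof
    fix F assume "F \<in> ultrafilters_containing S A"
    then have F: "F \<in> ultrafilters S" "A \<in> F"
      by (auto simp: ultrafilters_containing_def)
    have "\<exists>G. G \<in> U \<and> G \<in> V" if V: "openin (stone_cech S) V" "F \<in> V" for V
    proof -
      obtain B where B: "B \<in> F" "B \<subseteq> S" "ultrafilters_containing S B \<subseteq> V"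
        using V by (rule stone_cech_nhdE)
      then obtain x where x: "x \<in> A" "x \<in> B"
        using F ultrafilters_Int[OF F] ultrafilters_nonempty[OF F(1)] by blast
      have "principal_ultrafilter S x \<in> V"
        by (rule subsetD[OF B(3) principal_ultrafilter_in_containing[OF B(2) x(2)]])
      then show ?thesis
        using x by (auto simp: A_def)
    qed
    then show "F \<in> stone_cech S closure_of U"
      using F by (auto simp: in_closure_of)
  qed
  ultimately have "stone_cech S closure_of U = ultrafilters_containing S A"
    by blast
  then show "openin (stone_cech S) (stone_cech S closure_of U)"
    by (simp add: openin_ultrafilters_containing)
qed

lemma principal_ultrafilter_isolated:
  assumes "x \<in> S"
  shows "ultrafilters_containing S {x} = {principal_ultrafilter S x}"
proof
  show "{principal_ultrafilter S x} \<subseteq> ultrafilters_containing S {x}"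
    using principal_ultrafilter[OF assms] assms
    by (auto simp: ultrafilters_containing_def principal_ultrafilter_def)
  show "ultrafilters_containing S {x} \<subseteq> {principal_ultrafilter S x}"
  proof
    fix F assume "F \<in> ultrafilters_containing S {x}"
    then have F: "F \<in> ultrafilters S" "{x} \<in> F"
      by (auto simp: ultrafilters_containing_def)
    have "A \<in> F \<longleftrightarrow> A \<subseteq> S \<and> x \<in> A" for A
      using ultrafilters_Int[OF F(1,2), of A] ultrafilters_nonempty[OF F(1)]
        ultrafilters_mono[OF F, of A] ultrafilters_subset[OF F(1)] by fastforce
    then show "F \<in> {principal_ultrafilter S x}"
      by (auto simp: principal_ultrafilter_def)
  qed
qed

text \<open>
  The principal ultrafilters form a dense set, and being isolated points they belong to every dense
  set.
\<close>

lemma topological_density_stone_cech: "topological_density (stone_cech S) =o |S|"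
proof -
  have "dense_subset (stone_cech S) (principal_ultrafilter S ` S)"
    unfolding dense_subset_def
  proof (intro conjI subset_antisym closure_of_subset_topspace)
    show "topspace (stone_cech S) \<subseteq> stone_cech S closure_of principal_ultrafilter S ` S"
    proof
      fix F assume F: "F \<in> topspace (stone_cech S)"
      have "\<exists>G. G \<in> principal_ultrafilter S ` S \<and> G \<in> V" if V: "openin (stone_cech S) V" "F \<in> V" for V
      proof -
        obtain B where B: "B \<in> F" "B \<subseteq> S" "ultrafilters_containing S B \<subseteq> V"
          "F \<in> ultrafilters S"
          using V by (rule stone_cech_nhdE)
        obtain x where x: "x \<in> B"
          using ultrafilters_nonempty[OF B(4,1)] by blast
        have "principal_ultrafilter S x \<in> V" "x \<in> S"
          using subsetD[OF B(3) principal_ultrafilter_in_containing[OF B(2) x]] x B(2) by auto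
        then show ?thesis
          by blast
      qed
      then show "F \<in> stone_cech S closure_of principal_ultrafilter S ` S"
        using F by (auto simp: in_closure_of)
    qed
  qed (use principal_ultrafilter in auto)
  then have "topological_density (stone_cech S) \<le>o |S|"
    using topological_density(2) card_of_image ordLeq_transitive by blast
  moreover have "|S| \<le>o topological_density (stone_cech S)"
  proof -
    obtain E where E: "dense_subset (stone_cech S) E" "topological_density (stone_cech S) = |E|"
      using topological_density(1) by blast
    have "principal_ultrafilter S x \<in> E" if x: "x \<in> S" for x
    proof -
      have "principal_ultrafilter S x \<in> stone_cech S closure_of E"
        using E(1) principal_ultrafilter[OF x] by (simp add: dense_subset_def)
      then have "\<exists>G. G \<in> E \<and> G \<in> {principal_ultrafilter S x}"
        using openin_ultrafilters_containing[of S "{x}"]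
        unfolding in_closure_of principal_ultrafilter_isolated[OF x] by (metis singletonI)
      then show ?thesis
        by simp
    qed
    moreover have "inj_on (principal_ultrafilter S) S"
    proof (rule inj_onI)
      fix x y assume "x \<in> S" "principal_ultrafilter S x = principal_ultrafilter S y"
      then have "{x} \<in> principal_ultrafilter S y"
        by (metis (mono_tags) empty_subsetI insert_subset mem_Collect_eq principal_ultrafilter_def singletonI)
      then show "x = y"
        by (simp add: principal_ultrafilter_def)
    qed
    ultimately have "|S| \<le>o |E|"
      by (metis card_of_ordLeq image_subsetI)
    then show ?thesis
      by (simp add: E(2))
  qed
  ultimately show ?thesis
    by (simp add: ordIso_iff_ordLeq)
qed

lemma card_of_finite_subsets:
  assumes "infinite B"
  shows "|{C. C \<subseteq> B \<and> finite C}| \<le>o |B|"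
proof -
  have step: "|{C. C \<subseteq> B \<and> finite C \<and> card C = n}| \<le>o |B|" for n
  proof (induction n)
    case 0
    have "{C. C \<subseteq> B \<and> finite C \<and> card C = 0} = {{}}"
      by auto
    moreover have "B \<noteq> {}"
      using assms by auto
    ultimately show ?case
      using card_of_singl_ordLeq by metis
  next
    case (Suc n)
    let ?N = "{C. C \<subseteq> B \<and> finite C \<and> card C = n}"
    have "{C. C \<subseteq> B \<and> finite C \<and> card C = Suc n} \<subseteq> (\<lambda>(b, C). insert b C) ` (B \<times> ?N)"
    proof
      fix C assume "C \<in> {C. C \<subseteq> B \<and> finite C \<and> card C = Suc n}"
      then have C: "C \<subseteq> B" "finite C" "card C = Suc n"
        by auto
      then obtain b D where "C = insert b D" "b \<notin> D" "card D = n"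
        by (metis card_Suc_eq)
      with C show "C \<in> (\<lambda>(b, C). insert b C) ` (B \<times> ?N)"
        by (intro image_eqI[of _ _ "(b, D)"]) auto
    qed
    then have "|{C. C \<subseteq> B \<and> finite C \<and> card C = Suc n}| \<le>o |B \<times> ?N|"
      by (rule ordLeq_transitive[OF card_of_mono1 card_of_image])
    also have "|B \<times> ?N| \<le>o |B|"
      by (rule card_of_Sigma_ordLeq_infinite[OF assms]) (use Suc in \<open>auto simp: card_of_mono1\<close>)
    finally show ?case .
  qed
  have "{C. C \<subseteq> B \<and> finite C} = (\<Union>n. {C. C \<subseteq> B \<and> finite C \<and> card C = n})"
    by auto
  with step assms show ?thesis
    by (simp add: card_of_UNION_ordLeq_infinite flip: infinite_iff_card_of_nat)
qed

text \<open>
  The sets \<open>ultrafilters_containing S A\<close> form a base that is indexed by the subsets of \<open>S\<close>.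
  Conversely, each of these sets is compact and open, hence a finite union of members of any given
  base, and an infinite set has no more finite subsets than elements.
\<close>

lemma topological_weight_stone_cech:
  assumes "infinite S"
  shows "topological_weight (stone_cech S) =o |Pow S|"
proof -
  have "base_of_topology (stone_cech S) (ultrafilters_containing S ` Pow S)"
    unfolding base_of_topology_def openin_topology_base_unique
  proof (intro conjI allI impI)
    show "openin (stone_cech S) V" if "V \<in> ultrafilters_containing S ` Pow S" for V
      using that openin_ultrafilters_containing by blast
    show "\<exists>V. V \<in> ultrafilters_containing S ` Pow S \<and> F \<in> V \<and> V \<subseteq> U"
      if "openin (stone_cech S) U \<and> F \<in> U" for U F
    proof -
      have U: "openin (stone_cech S) U" "F \<in> U"
        using that by simp_all
      obtain A where "A \<in> F" "A \<subseteq> S" "ultrafilters_containing S A \<subseteq> U" "F \<in> ultrafilters S"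
        using U by (rule stone_cech_nhdE)
      then show ?thesis
        by (intro exI[of _ "ultrafilters_containing S A"]) (auto simp: ultrafilters_containing_def)
    qed
  qed
  then have "topological_weight (stone_cech S) \<le>o |Pow S|"
    using topological_weight(2) card_of_image ordLeq_transitive by blast
  moreover have "|Pow S| \<le>o topological_weight (stone_cech S)"
  proof -
    obtain \<B> where \<B>: "base_of_topology (stone_cech S) \<B>" "topological_weight (stone_cech S) = |\<B>|"
      using topological_weight(1) by blast
    have "\<exists>\<C>. (\<C> \<subseteq> \<B> \<and> finite \<C>) \<and> \<Union>\<C> = ultrafilters_containing S A" if A: "A \<subseteq> S" for A
    proof -
      have "(arbitrary union_of (\<lambda>U. U \<in> \<B>)) (ultrafilters_containing S A)"
        using \<B>(1) openin_ultrafilters_containing by (metis base_of_topology_def)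
      then obtain \<U> where \<U>: "\<U> \<subseteq> \<B>" "\<Union>\<U> = ultrafilters_containing S A"
        by (auto simp: union_of_def)
      have "openin (stone_cech S) U" if "U \<in> \<U>" for U
        using \<B>(1) \<U>(1) that unfolding base_of_topology_def openin_topology_base_unique by blast
      moreover have "compactin (stone_cech S) (ultrafilters_containing S A)"
        by (rule closedin_compact_space[OF compact_space_stone_cech closedin_ultrafilters_containing[OF A]])
      ultimately obtain \<C> where "finite \<C>" "\<C> \<subseteq> \<U>" "ultrafilters_containing S A \<subseteq> \<Union>\<C>"
        using \<U>(2) unfolding compactin_def by (metis order_refl)
      moreover have "\<Union>\<C> \<subseteq> \<Union>\<U>"
        using \<open>\<C> \<subseteq> \<U>\<close> by (rule Union_mono)
      ultimately show ?thesis
        using \<U> by (intro exI[of _ \<C>]) simp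
    qed
    then obtain c where c: "\<And>A. A \<subseteq> S \<Longrightarrow> c A \<subseteq> \<B> \<and> finite (c A)"
      "\<And>A. A \<subseteq> S \<Longrightarrow> \<Union>(c A) = ultrafilters_containing S A"
      by metis
    have "inj_on c (Pow S)"
    proof (rule inj_onI)
      fix A B assume AB: "A \<in> Pow S" "B \<in> Pow S" "c A = c B"
      then have "ultrafilters_containing S A = ultrafilters_containing S B"
        using c(2)[of A] c(2)[of B] by simp
      with AB show "A = B"
        by (intro ultrafilters_containing_inj[of A S B]) simp_all
    qed
    moreover have "c ` Pow S \<subseteq> {\<C>. \<C> \<subseteq> \<B> \<and> finite \<C>}"
      using c(1) by auto
    ultimately have le: "|Pow S| \<le>o |{\<C>. \<C> \<subseteq> \<B> \<and> finite \<C>}|"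
      by (intro card_of_ordLeq[THEN iffD1] exI conjI)
    have "infinite \<B>"
    proof
      assume "finite \<B>"
      then have "finite {\<C>. \<C> \<subseteq> \<B> \<and> finite \<C>}"
        by simp
      then have "finite (Pow S)"
        using le card_of_ordLeq_finite by blast
      with assms show False
        by simp
    qed
    then have "|{\<C>. \<C> \<subseteq> \<B> \<and> finite \<C>}| \<le>o |\<B>|"
      by (rule card_of_finite_subsets)
    with le show ?thesis
      unfolding \<B>(2) by (rule ordLeq_transitive)
  qed
  ultimately show ?thesis
    by (simp add: ordIso_iff_ordLeq)
qed

text \<open>
  An ultrafilter on a set as a filter on the whole type, so that the limit theorems for filters
  apply to it.
\<close>

definition convergence_along :: "'a set set \<Rightarrow> 'a filter" where
  "convergence_along F = Abs_filter (\<lambda>P. \<exists>A\<in>F. \<forall>x\<in>A. P x)"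

lemma eventually_convergence_along:
  assumes "F \<in> ultrafilters S"
  shows "eventually P (convergence_along F) \<longleftrightarrow> (\<exists>A\<in>F. \<forall>x\<in>A. P x)"
  unfolding convergence_along_def
proof (rule eventually_Abs_filter)
  show "is_filter (\<lambda>P. \<exists>A\<in>F. \<forall>x\<in>A. P x)"
    using ultrafilters_top[OF assms] ultrafilters_Int[OF assms]
    by unfold_locales (blast, metis IntD1 IntD2, blast)
qed

lemma convergence_along_neq_bot:
  assumes "F \<in> ultrafilters S"
  shows "convergence_along F \<noteq> bot"
  using ultrafilters_nonempty[OF assms]
  by (auto simp: trivial_limit_def eventually_convergence_along[OF assms])

text \<open>
  By compactness there is a cluster point.  It is a limit, because an ultrafilter that does not
  contain the preimage of a neighbourhood contains its complement.
\<close>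

lemma bounded_tendsto_along_ultrafilter:
  fixes g :: "'a \<Rightarrow> real"
  assumes F: "F \<in> ultrafilters S" and "bounded (g ` S)"
  shows "(g \<longlongrightarrow> Lim (convergence_along F) g) (convergence_along F)"
proof -
  let ?F = "filtermap g (convergence_along F)"
  have "?F \<noteq> bot"
    by (simp add: filtermap_bot_iff convergence_along_neq_bot[OF F])
  moreover have "eventually (\<lambda>t. t \<in> closure (g ` S)) ?F"
    unfolding eventually_filtermap eventually_convergence_along[OF F]
    by (rule bexI[OF _ ultrafilters_top[OF F]]) (simp add: closure_subset[THEN subsetD])
  moreover have "compact (closure (g ` S))"
    using assms(2) by simp
  ultimately obtain l where l: "inf (nhds l) ?F \<noteq> bot"
    unfolding compact_filter by blast
  have lim: "(g \<longlongrightarrow> l) (convergence_along F)"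
    unfolding tendsto_def
  proof (intro allI impI)
    fix V assume V: "open V" "l \<in> V"
    let ?A = "{x \<in> S. g x \<in> V}"
    have "?A \<in> F"
    proof (rule ccontr)
      assume "?A \<notin> F"
      then have "S - ?A \<in> F"
        using ultrafilters_Diff_iff[OF F] by auto
      then have "eventually (\<lambda>t. t \<notin> V) ?F"
        unfolding eventually_filtermap eventually_convergence_along[OF F] by (rule bexI[rotated]) auto
      moreover have "eventually (\<lambda>t. t \<in> V) (nhds l)"
        using V by (simp add: eventually_nhds_in_open)
      ultimately have "eventually (\<lambda>t. False) (inf (nhds l) ?F)"
        unfolding eventually_inf by blast
      with l show False
        by (simp add: trivial_limit_def)
    qed
    then show "eventually (\<lambda>x. g x \<in> V) (convergence_along F)"
      unfolding eventually_convergence_along[OF F] by (rule bexI[rotated]) simp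
  qed
  then have "Lim (convergence_along F) g = l"
    by (rule tendsto_Lim[OF convergence_along_neq_bot[OF F]])
  with lim show ?thesis
    by simp
qed

definition stone_cech_extension :: "'a set \<Rightarrow> ('a \<Rightarrow> real) \<Rightarrow> 'a set set \<Rightarrow> real" where
  "stone_cech_extension S g = (\<lambda>F\<in>ultrafilters S. Lim (convergence_along F) g)"

lemma stone_cech_extension_eqI:
  assumes "F \<in> ultrafilters S" "(g \<longlongrightarrow> l) (convergence_along F)"
  shows "stone_cech_extension S g F = l"
  using tendsto_Lim[OF convergence_along_neq_bot[OF assms(1)] assms(2)] assms(1)
  by (simp add: stone_cech_extension_def)

lemma stone_cech_extension_cong:
  assumes "\<And>x. x \<in> S \<Longrightarrow> g x = h x"
  shows "stone_cech_extension S g = stone_cech_extension S h"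
  unfolding stone_cech_extension_def
proof (rule restrict_ext)
  fix F assume F: "F \<in> ultrafilters S"
  have "eventually (\<lambda>x. g x = h x) (convergence_along F)"
    unfolding eventually_convergence_along[OF F]
    by (rule bexI[OF _ ultrafilters_top[OF F]]) (simp add: assms)
  then show "Lim (convergence_along F) g = Lim (convergence_along F) h"
    by (rule Lim_cong) simp
qed

lemma stone_cech_extension_tendsto:
  fixes g :: "'a \<Rightarrow> real"
  assumes "F \<in> ultrafilters S" "bounded (g ` S)"
  shows "(g \<longlongrightarrow> stone_cech_extension S g F) (convergence_along F)"
  using bounded_tendsto_along_ultrafilter[OF assms] assms(1) by (simp add: stone_cech_extension_def)

lemma stone_cech_extension_in_closed:
  fixes g :: "'a \<Rightarrow> real"
  assumes "F \<in> ultrafilters S" "bounded (g ` S)" "A \<in> F" "closed C" "\<And>x. x \<in> A \<Longrightarrow> g x \<in> C"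
  shows "stone_cech_extension S g F \<in> C"
proof (rule Lim_in_closed_set[OF assms(4) _ convergence_along_neq_bot[OF assms(1)]])
  show "eventually (\<lambda>x. g x \<in> C) (convergence_along F)"
    unfolding eventually_convergence_along[OF assms(1)] using assms(3) by (rule bexI[rotated]) (simp add: assms(5))
qed (rule stone_cech_extension_tendsto[OF assms(1,2)])

lemma stone_cech_extension_in_C_space:
  fixes g :: "'a \<Rightarrow> real"
  assumes "bounded (g ` S)"
  shows "stone_cech_extension S g \<in> mspace (C_space (stone_cech S))"
proof -
  have "openin (stone_cech S) {F \<in> ultrafilters S. stone_cech_extension S g F \<in> V}" if "open V" for V
    unfolding openin_stone_cech
  proof (intro conjI ballI)
    fix F assume "F \<in> {F \<in> ultrafilters S. stone_cech_extension S g F \<in> V}"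
    then have F: "F \<in> ultrafilters S" "stone_cech_extension S g F \<in> V"
      by auto
    obtain \<epsilon> where \<epsilon>: "\<epsilon> > 0" "cball (stone_cech_extension S g F) \<epsilon> \<subseteq> V"
      using \<open>open V\<close>[unfolded open_contains_cball, rule_format, OF F(2)] by (elim exE conjE)
    have "eventually (\<lambda>x. dist (g x) (stone_cech_extension S g F) < \<epsilon>) (convergence_along F)"
      using stone_cech_extension_tendsto[OF F(1) assms] \<epsilon>(1) by (rule tendstoD)
    then obtain A where A: "A \<in> F" "\<And>x. x \<in> A \<Longrightarrow> dist (g x) (stone_cech_extension S g F) < \<epsilon>"
      unfolding eventually_convergence_along[OF F(1)] by blast
    have "stone_cech_extension S g G \<in> cball (stone_cech_extension S g F) \<epsilon>"
      if "G \<in> ultrafilters_containing S A" for G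
      by (rule stone_cech_extension_in_closed[of G S _ A])
         (use that assms A(2) in \<open>auto simp: ultrafilters_containing_def dist_commute less_imp_le\<close>)
    then show "\<exists>A\<in>F. ultrafilters_containing S A \<subseteq> {F \<in> ultrafilters S. stone_cech_extension S g F \<in> V}"
      using A(1) \<epsilon>(2) by (intro bexI[of _ A]) (auto simp: ultrafilters_containing_def)
  qed auto
  then have "continuous_map (stone_cech S) euclideanreal (stone_cech_extension S g)"
    by (simp add: continuous_map_def)
  then show ?thesis
    unfolding mspace_C_space[OF compact_space_stone_cech]
    by (simp add: stone_cech_extension_def)
qed

text \<open>
  The values of \<open>h\<close> at an ultrafilter are, by continuity, the limits of its values at the principal
  ultrafilters.
\<close>

lemma stone_cech_extension_surj:
  assumes "h \<in> mspace (C_space (stone_cech S))"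
  obtains g where "bounded (g ` S)" "stone_cech_extension S g = h"
proof -
  have h: "h \<in> extensional (ultrafilters S)" "continuous_map (stone_cech S) euclideanreal h"
    using assms unfolding mspace_C_space[OF compact_space_stone_cech] by auto
  define g where "g x = h (principal_ultrafilter S x)" for x
  have "compactin euclideanreal (h ` ultrafilters S)"
    using image_compactin[OF _ h(2)] compact_space_stone_cech[of S] by (simp add: compact_space_def)
  then have "bounded (h ` ultrafilters S)"
    by (simp add: compact_imp_bounded)
  then have "bounded (g ` S)"
    by (rule bounded_subset) (auto simp: g_def principal_ultrafilter)
  moreover have "stone_cech_extension S g F = h F" if F: "F \<in> ultrafilters S" for F
  proof (rule stone_cech_extension_eqI[OF F])
    show "(g \<longlongrightarrow> h F) (convergence_along F)"
      unfolding tendsto_def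
    proof (intro allI impI)
      fix V assume V: "open V" "h F \<in> V"
      then have "openin (stone_cech S) {G \<in> ultrafilters S. h G \<in> V}"
        using h(2) by (simp add: continuous_map_def)
      moreover have "F \<in> {G \<in> ultrafilters S. h G \<in> V}"
        using F V(2) by simp
      ultimately obtain A where A: "A \<in> F" "A \<subseteq> S"
        "ultrafilters_containing S A \<subseteq> {G \<in> ultrafilters S. h G \<in> V}"
        by (rule stone_cech_nhdE)
      have "g x \<in> V" if "x \<in> A" for x
        using principal_ultrafilter_in_containing[OF A(2) that] A(3) by (auto simp: g_def)
      then show "eventually (\<lambda>x. g x \<in> V) (convergence_along F)"
        unfolding eventually_convergence_along[OF F] by (intro bexI[OF _ A(1)] ballI)
    qed
  qed
  then have "stone_cech_extension S g = h"
    by (intro extensionalityI[OF _ h(1)]) (auto simp: stone_cech_extension_def)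
  ultimately show ?thesis
    using that by blast
qed

section \<open>The operator onto the continuous functions\<close>

theorem corollary4p2:
  fixes e :: "'a::metric_space"
  assumes "infinite (UNIV :: 'a set)"
  shows "\<exists>(K :: 'a set set topology) (T :: ('a \<Rightarrow> real) \<Rightarrow> ('a set set \<Rightarrow> real)).
           compact_space K \<and> Hausdorff_space K \<and> extremally_disconnected K \<and>
           topological_density K =o topological_density (euclidean :: 'a topology) \<and>
           topological_weight K =o ctwo ^c topological_density (euclidean :: 'a topology) \<and>
           linear_Lip0_C e K T \<and>
           continuous_map (mtopology_of (Lip0_space e)) (mtopology_of (C_space K)) T \<and>
           T ` mspace (Lip0_space e) = mspace (C_space K)"
proof -
  let ?d = "topological_density (euclidean :: 'a topology)"
  obtain D :: "'a set" where D: "discrete D" "|D| =o ?d"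
    by (rule discrete_subset_of_density_size)
  have "infinite D"
  proof
    assume "finite D"
    obtain F :: "'a set" where F: "dense_subset euclidean F" "?d = |F|"
      using topological_density(1) by blast
    have "finite F"
      using D(2) F(2) \<open>finite D\<close> card_of_ordIso_finite by metis
    then have "F = UNIV"
      using F(1) finite_imp_closed[of F] by (simp add: dense_subset_def)
    with \<open>finite F\<close> assms show False
      by simp
  qed
  obtain S :: "'a set" and r y where S: "|S| =o |D|" and sys: "bump_system S r y"
    using D(1) \<open>infinite D\<close> by (rule bump_system_exists)
  have "infinite S"
    using S \<open>infinite D\<close> card_of_ordIso_finite by blast
  have Sd: "|S| =o ?d"
    using S D(2) by (rule ordIso_transitive)
  let ?K = "stone_cech S"
  define q where "q f x = (f x - f (y x)) / dist x (y x)" for f :: "'a \<Rightarrow> real" and x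
  define T where "T f = stone_cech_extension S (q f)" for f
  have q_le: "\<bar>q f x\<bar> \<le> Lip_norm f" if "f \<in> Lip0 e" "x \<in> S" for f x
  proof -
    have "x \<noteq> y x"
      using sys that(2) by (auto simp: bump_system_def)
    then show ?thesis
      using Lip_norm_upper[OF that(1), of x "y x"] by (simp add: q_def divide_le_eq)
  qed
  have bdd: "bounded (q f ` S)" if "f \<in> Lip0 e" for f
    unfolding bounded_iff using q_le[OF that] by auto
  have add: "T (\<lambda>x. f x + g x) k = T f k + T g k"
    if "f \<in> Lip0 e" "g \<in> Lip0 e" "k \<in> ultrafilters S" for f g k
  proof -
    have q: "q (\<lambda>x. f x + g x) = (\<lambda>x. q f x + q g x)"
      by (rule ext) (simp add: q_def add_divide_distrib[symmetric])
    show ?thesis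
      unfolding T_def q
      by (intro stone_cech_extension_eqI stone_cech_extension_tendsto tendsto_add bdd that)
  qed
  have scale: "T (\<lambda>x. c * f x) k = c * T f k" if "f \<in> Lip0 e" "k \<in> ultrafilters S" for c f k
  proof -
    have q: "q (\<lambda>x. c * f x) = (\<lambda>x. c * q f x)"
      by (rule ext) (simp add: q_def right_diff_distrib)
    show ?thesis
      unfolding T_def q
      by (intro stone_cech_extension_eqI stone_cech_extension_tendsto tendsto_mult_left bdd that)
  qed
  have T_in: "T f \<in> mspace (C_space ?K)" if "f \<in> Lip0 e" for f
    unfolding T_def using bdd[OF that] by (rule stone_cech_extension_in_C_space)
  have T_surj: "\<exists>f\<in>Lip0 e. T f = h" if h: "h \<in> mspace (C_space ?K)" for h
  proof -
    obtain a where a: "bounded (a ` S)" "stone_cech_extension S a = h"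
      using h by (rule stone_cech_extension_surj)
    obtain f where f: "f \<in> Lip0 e" "\<And>x. x \<in> S \<Longrightarrow> (f x - f (y x)) / dist x (y x) = a x"
      using Lip0_interpolation[OF sys a(1), of e] by metis
    have "T f = h"
      unfolding T_def a(2)[symmetric] by (rule stone_cech_extension_cong) (simp add: q_def f(2))
    with f(1) show ?thesis
      by blast
  qed
  obtain x where "x \<in> S"
    using \<open>infinite S\<close> by fastforce
  then have K_ne: "topspace ?K \<noteq> {}"
    using principal_ultrafilter[of x S] by auto
  have T_le: "mdist (C_space ?K) (T f) (T g) \<le> 1 * mdist (Lip0_space e) f g"
    if fg: "f \<in> Lip0 e" "g \<in> Lip0 e" for f g
  proof -
    let ?h = "\<lambda>x. f x - g x"
    have h: "?h \<in> Lip0 e"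
      using fg by (rule Lip0_diff)
    have "\<bar>T f k - T g k\<bar> \<le> Lip_norm ?h" if k: "k \<in> topspace ?K" for k
    proof -
      have k: "k \<in> ultrafilters S"
        using k by simp
      \<comment> \<open>By additivity; this saves a separate treatment of differences.\<close>
      have "T f k = T g k + T ?h k"
        using add[OF fg(2) h k] by simp
      moreover have "T ?h k \<in> cball 0 (Lip_norm ?h)"
        unfolding T_def using q_le[OF h]
        by (intro stone_cech_extension_in_closed[OF k bdd[OF h] ultrafilters_top[OF k]]) auto
      ultimately show ?thesis
        by simp
    qed
    then have "mdist (C_space ?K) (T f) (T g) \<le> Lip_norm ?h"
      unfolding mdist_C_space[OF T_in[OF fg(1)] T_in[OF fg(2)] K_ne] by (rule cSUP_least[OF K_ne])
    then show ?thesis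
      using fg by (simp add: Lip0_space[OF assms] Lip0_dist_def)
  qed
  have "Lipschitz_continuous_map (Lip0_space e) (C_space ?K) T"
    unfolding Lipschitz_continuous_map_def Lip0_space(1)[OF assms]
    using T_in T_le by (intro conjI exI[of _ 1] funcsetI ballI)
  then have cont: "continuous_map (mtopology_of (Lip0_space e)) (mtopology_of (C_space ?K)) T"
    by (rule Lipschitz_continuous_imp_continuous_map)
  have weight: "topological_weight ?K =o ctwo ^c ?d"
  proof -
    have "|Pow S| =o ctwo ^c |S|"
      unfolding ctwo_def cexp_def Field_card_of by (rule card_of_Pow_Func)
    moreover have "ctwo ^c |S| =o ctwo ^c ?d"
      by (rule cexp_cong2[OF Sd Card_order_ctwo card_of_Card_order])
    ultimately show ?thesis
      using topological_weight_stone_cech[OF \<open>infinite S\<close>] by (meson ordIso_transitive)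
  qed
  show ?thesis
  proof (intro exI conjI)
    show "compact_space ?K"
      by (rule compact_space_stone_cech)
    show "Hausdorff_space ?K"
      by (rule Hausdorff_space_stone_cech)
    show "extremally_disconnected ?K"
      by (rule extremally_disconnected_stone_cech)
    show "topological_density ?K =o ?d"
      using topological_density_stone_cech Sd by (rule ordIso_transitive)
    show "linear_Lip0_C e ?K T"
      unfolding linear_Lip0_C_def using add scale by simp
    show "T ` mspace (Lip0_space e) = mspace (C_space ?K)"
      unfolding Lip0_space(1)[OF assms] using T_in T_surj by blast
  qed (rule weight cont)+
qed

end
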